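(* Let $(M,\nabla)$ be an affine manifold and let $\mathcal{O}$ be a connected open subset of $TM$. Suppose there exists a real-valued function $s(x,y)$ such that $\operatorname{Spec}\{\mathcal{J}(x)\}=s(x,y)\operatorname{Spec}\{\mathcal{J}(y)\}\ne\{0\}$ for all $x,y\in\mathcal{O}$. Then: (1) $\operatorname{Tr}\{\mathcal{J}(x)^k\}=s(x,y)^k\operatorname{Tr}\{\mathcal{J}(y)^k\}$ for any $x,y\in\mathcal{O}$ and any positive integer $k$. (2) $\operatorname{Spec}\{\mathcal{J}(x)\}=|s(x,y)|\operatorname{Spec}\{\mathcal{J}(y)\}\ne\{0\}$ for all $x,y\in\mathcal{O}$. (3) There exists a positive integer $k$ such that $$|s(x,y)|=\left\{\frac{\operatorname{Tr}\{\mathcal{J}(x)^k\}}{\operatorname{Tr}\{\mathcal{J}(y)^k\}}\right\}^{1/k}\text{ for any }x,y\in\mathcal{O}.$$ (4) The function $|s(x,y)|$ is smooth on $\mathcal{O}\times\mathcal{O}$.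
   Context: An affine manifold $(M,\nabla)$ is a smooth manifold $M$ with a torsion-free connection $\nabla$. Let $\mathcal{R}(x,y)=\nabla_x\nabla_y-\nabla_y\nabla_x-\nabla_{[x,y]}$ be its curvature operator. The Jacobi operator of $x\in T_PM$ is the endomorphism $\mathcal{J}(x):y\mapsto\mathcal{R}(y,x)x$ of $T_PM$. For a linear map $T$ of a finite-dimensional real vector space, $\operatorname{Spec}\{T\}\subset\mathbb{C}$ is the set of complex roots of the characteristic polynomial $\det(T-\lambda\operatorname{Id})$.
   Formalization: Claim (1) is stated only for x,y where Spec{J(x)} = s(x,y)Spec{J(y)} also holds with multiplicities, since with Spec a set it can fail (eigenvalues 0,1,1,-1 with s=-1); M has positive dimension. Claims (2)-(4) use only the set hypothesis, and (2) is also shown with multiplicities. *)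

theory Defs
  imports "HOL-Analysis.Analysis" "HOL-Computational_Algebra.Polynomial"
begin

section \<open>Smooth maps between Euclidean spaces\<close>

text \<open>Meaningful for open \<open>S\<close> only, since derivatives are taken with respect to the full
  neighbourhood filter.\<close>

fun C_k_on :: "nat \<Rightarrow> 'a::euclidean_space set \<Rightarrow> ('a \<Rightarrow> 'b::euclidean_space) \<Rightarrow> bool" where
  "C_k_on 0 S f \<longleftrightarrow> continuous_on S f"
| "C_k_on (Suc k) S f \<longleftrightarrow>
     (\<forall>x\<in>S. f differentiable (at x)) \<and> (\<forall>v. C_k_on k S (\<lambda>x. frechet_derivative f (at x) v))"

definition smooth_on :: "'a::euclidean_space set \<Rightarrow> ('a \<Rightarrow> 'b::euclidean_space) \<Rightarrow> bool" where
  "smooth_on S f \<longleftrightarrow> (\<forall>k. C_k_on k S f)"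


section \<open>Smooth manifolds\<close>

text \<open>A chart is a pair of a domain and a coordinate map, of which only the values on the domain
  matter. The manifold determined by an atlas is the union of the chart domains, an open subset of
  a Hausdorff second countable space; its dimension is \<open>CARD('n)\<close>, hence positive.\<close>

type_synonym ('m, 'n) chart = "'m set \<times> ('m \<Rightarrow> real ^ 'n)"

abbreviation chart_dom :: "('m, 'n) chart \<Rightarrow> 'm set" where
  "chart_dom c \<equiv> fst c"

abbreviation chart_map :: "('m, 'n) chart \<Rightarrow> 'm \<Rightarrow> real ^ 'n" where
  "chart_map c \<equiv> snd c"

abbreviation chart_image :: "('m, 'n) chart \<Rightarrow> (real ^ 'n) set" where
  "chart_image c \<equiv> chart_map c ` chart_dom c"

abbreviation chart_inv :: "('m, 'n) chart \<Rightarrow> real ^ 'n \<Rightarrow> 'm" where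
  "chart_inv c \<equiv> inv_into (chart_dom c) (chart_map c)"

definition is_chart :: "('m::topological_space, 'n::finite) chart \<Rightarrow> bool" where
  "is_chart c \<longleftrightarrow> open (chart_dom c) \<and> open (chart_image c) \<and>
     (\<exists>g. homeomorphism (chart_dom c) (chart_image c) (chart_map c) g)"

definition transition :: "('m, 'n) chart \<Rightarrow> ('m, 'n) chart \<Rightarrow> real ^ 'n \<Rightarrow> real ^ 'n" where
  "transition c d = chart_map d \<circ> chart_inv c"

definition smooth_manifold ::
    "('m::{t2_space, second_countable_topology}, 'n::finite) chart set \<Rightarrow> bool" where
  "smooth_manifold A \<longleftrightarrow> (\<forall>c\<in>A. is_chart c) \<and>
     (\<forall>c\<in>A. \<forall>d\<in>A. smooth_on (chart_map c ` (chart_dom c \<inter> chart_dom d)) (transition c d))"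

definition smooth_fun :: "('m, 'n::finite) chart set \<Rightarrow> ('m \<Rightarrow> real) \<Rightarrow> bool" where
  "smooth_fun A f \<longleftrightarrow> (\<forall>c\<in>A. smooth_on (chart_image c) (f \<circ> chart_inv c))"


section \<open>Tangent vectors, tangent bundle\<close>

text \<open>A tangent vector at \<open>p\<close> is the family of its component vectors in the charts around \<open>p\<close>,
  related by the Jacobians of the transition maps. It is extended by \<open>0\<close> to all other charts, so
  that equality of tangent vectors is equality of functions.\<close>

type_synonym ('m, 'n) tvec = "('m, 'n) chart \<Rightarrow> real ^ 'n"

definition tangent_space ::
    "('m, 'n::finite) chart set \<Rightarrow> 'm \<Rightarrow> ('m, 'n) tvec set" where
  "tangent_space A p = {v.
     (\<forall>c. \<not> (c \<in> A \<and> p \<in> chart_dom c) \<longrightarrow> v c = 0) \<and>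
     (\<forall>c\<in>A. \<forall>d\<in>A. p \<in> chart_dom c \<and> p \<in> chart_dom d \<longrightarrow>
        v d = frechet_derivative (transition c d) (at (chart_map c p)) (v c))}"

text \<open>The tangent vector at \<open>p\<close> with given components in the chart \<open>c\<close>.\<close>

definition tangent_of ::
    "('m, 'n::finite) chart set \<Rightarrow> ('m, 'n) chart \<Rightarrow> 'm \<Rightarrow> real ^ 'n \<Rightarrow> ('m, 'n) tvec" where
  "tangent_of A c p u =
     (\<lambda>d. if d \<in> A \<and> p \<in> chart_dom d
          then frechet_derivative (transition c d) (at (chart_map c p)) u else 0)"

type_synonym ('m, 'n) tpoint = "'m \<times> ('m, 'n) tvec"

definition TM :: "('m, 'n::finite) chart set \<Rightarrow> ('m, 'n) tpoint set" where
  "TM A = {(p, v). p \<in> (\<Union>c\<in>A. chart_dom c) \<and> v \<in> tangent_space A p}"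

text \<open>Inverse of the bundle chart of \<open>TM\<close> induced by \<open>c\<close>, and the part of a set \<open>W \<subseteq> TM\<close> over
  the domain of \<open>c\<close> as seen in that bundle chart.\<close>

definition TM_chart_inv ::
    "('m, 'n::finite) chart set \<Rightarrow> ('m, 'n) chart \<Rightarrow> (real ^ 'n) \<times> (real ^ 'n) \<Rightarrow> ('m, 'n) tpoint"
  where
  "TM_chart_inv A c a =
     (chart_inv c (fst a), tangent_of A c (chart_inv c (fst a)) (snd a))"

definition TM_chart_part ::
    "('m, 'n::finite) chart set \<Rightarrow> ('m, 'n) chart \<Rightarrow> ('m, 'n) tpoint set \<Rightarrow>
       ((real ^ 'n) \<times> (real ^ 'n)) set" where
  "TM_chart_part A c W = {a. fst a \<in> chart_image c \<and> TM_chart_inv A c a \<in> W}"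

definition TM_topology :: "('m, 'n::finite) chart set \<Rightarrow> ('m, 'n) tpoint topology" where
  "TM_topology A = topology (\<lambda>W. W \<subseteq> TM A \<and> (\<forall>c\<in>A. open (TM_chart_part A c W)))"

lemma openin_TM_topology:
  "openin (TM_topology A) W \<longleftrightarrow> W \<subseteq> TM A \<and> (\<forall>c\<in>A. open (TM_chart_part A c W))"
proof -
  have int: "TM_chart_part A c (S \<inter> T) = TM_chart_part A c S \<inter> TM_chart_part A c T" for c S T
    by (auto simp: TM_chart_part_def)
  have un: "TM_chart_part A c (\<Union>K) = (\<Union>W\<in>K. TM_chart_part A c W)" for c K
    by (auto simp: TM_chart_part_def)
  have "istopology (\<lambda>W. W \<subseteq> TM A \<and> (\<forall>c\<in>A. open (TM_chart_part A c W)))"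
    unfolding istopology_def by (auto simp: int un)
  then show ?thesis
    by (simp add: TM_topology_def topology_inverse')
qed

text \<open>Smoothness on \<open>W \<times> W\<close> of a function of two points of the bundle, for \<open>W\<close> open in \<open>TM\<close>,
  in the product charts of \<open>TM \<times> TM\<close>.\<close>

definition smooth_on_TM2 ::
    "('m, 'n::finite) chart set \<Rightarrow> ('m, 'n) tpoint set \<Rightarrow>
       (('m, 'n) tpoint \<Rightarrow> ('m, 'n) tpoint \<Rightarrow> real) \<Rightarrow> bool" where
  "smooth_on_TM2 A W f \<longleftrightarrow>
     (\<forall>c\<in>A. \<forall>d\<in>A. smooth_on (TM_chart_part A c W \<times> TM_chart_part A d W)
        (\<lambda>(a, b). f (TM_chart_inv A c a) (TM_chart_inv A d b)))"


section \<open>Vector fields\<close>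

text \<open>The tangent space at a point outside the manifold is \<open>{0}\<close>, so the first condition below
  also makes vector fields vanish there.\<close>

type_synonym ('m, 'n) vfield = "'m \<Rightarrow> ('m, 'n) tvec"

definition vf_rep :: "('m, 'n) chart \<Rightarrow> ('m, 'n) vfield \<Rightarrow> real ^ 'n \<Rightarrow> real ^ 'n" where
  "vf_rep c X = (\<lambda>u. X (chart_inv c u) c)"

definition vfields :: "('m, 'n::finite) chart set \<Rightarrow> ('m, 'n) vfield set" where
  "vfields A = {X. (\<forall>p. X p \<in> tangent_space A p) \<and>
     (\<forall>c\<in>A. smooth_on (chart_image c) (vf_rep c X))}"

definition vf_add :: "('m, 'n::finite) vfield \<Rightarrow> ('m, 'n) vfield \<Rightarrow> ('m, 'n) vfield" where
  "vf_add X Y = (\<lambda>p c. X p c + Y p c)"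

definition vf_diff :: "('m, 'n::finite) vfield \<Rightarrow> ('m, 'n) vfield \<Rightarrow> ('m, 'n) vfield" where
  "vf_diff X Y = (\<lambda>p c. X p c - Y p c)"

definition vf_scale :: "('m \<Rightarrow> real) \<Rightarrow> ('m, 'n::finite) vfield \<Rightarrow> ('m, 'n) vfield" where
  "vf_scale f X = (\<lambda>p c. f p *\<^sub>R X p c)"

text \<open>The chart chosen at each point is immaterial in the next definition, and again in
  \<open>endo_matrix\<close> below, where a change of chart conjugates the matrix.\<close>

definition chart_at :: "('m, 'n) chart set \<Rightarrow> 'm \<Rightarrow> ('m, 'n) chart" where
  "chart_at A p = (SOME c. c \<in> A \<and> p \<in> chart_dom c)"

definition vf_apply ::
    "('m, 'n::finite) chart set \<Rightarrow> ('m, 'n) vfield \<Rightarrow> ('m \<Rightarrow> real) \<Rightarrow> 'm \<Rightarrow> real" where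
  "vf_apply A X f = (\<lambda>p. let c = chart_at A p in
     frechet_derivative (f \<circ> chart_inv c) (at (chart_map c p)) (X p c))"

text \<open>In coordinates, \<open>[X, Y]\<^sup>i = X\<^sup>j \<partial>\<^sub>j Y\<^sup>i - Y\<^sup>j \<partial>\<^sub>j X\<^sup>i\<close>.\<close>

definition lie_bracket ::
    "('m, 'n::finite) chart set \<Rightarrow> ('m, 'n) vfield \<Rightarrow> ('m, 'n) vfield \<Rightarrow> ('m, 'n) vfield" where
  "lie_bracket A X Y = (\<lambda>p c. if c \<in> A \<and> p \<in> chart_dom c
     then frechet_derivative (vf_rep c Y) (at (chart_map c p)) (X p c)
        - frechet_derivative (vf_rep c X) (at (chart_map c p)) (Y p c)
     else 0)"


section \<open>Affine manifolds, curvature and the Jacobi operator\<close>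

definition connection ::
    "('m, 'n::finite) chart set \<Rightarrow> (('m, 'n) vfield \<Rightarrow> ('m, 'n) vfield \<Rightarrow> ('m, 'n) vfield) \<Rightarrow> bool"
  where
  "connection A nabla \<longleftrightarrow>
     (\<forall>X\<in>vfields A. \<forall>Y\<in>vfields A. nabla X Y \<in> vfields A) \<and>
     (\<forall>X\<in>vfields A. \<forall>X'\<in>vfields A. \<forall>Y\<in>vfields A.
        nabla (vf_add X X') Y = vf_add (nabla X Y) (nabla X' Y)) \<and>
     (\<forall>X\<in>vfields A. \<forall>Y\<in>vfields A. \<forall>Y'\<in>vfields A.
        nabla X (vf_add Y Y') = vf_add (nabla X Y) (nabla X Y')) \<and>
     (\<forall>f. smooth_fun A f \<longrightarrow> (\<forall>X\<in>vfields A. \<forall>Y\<in>vfields A.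
        nabla (vf_scale f X) Y = vf_scale f (nabla X Y) \<and>
        nabla X (vf_scale f Y) = vf_add (vf_scale (vf_apply A X f) Y) (vf_scale f (nabla X Y))))"

definition torsion_free ::
    "('m, 'n::finite) chart set \<Rightarrow> (('m, 'n) vfield \<Rightarrow> ('m, 'n) vfield \<Rightarrow> ('m, 'n) vfield) \<Rightarrow> bool"
  where
  "torsion_free A nabla \<longleftrightarrow>
     (\<forall>X\<in>vfields A. \<forall>Y\<in>vfields A. vf_diff (nabla X Y) (nabla Y X) = lie_bracket A X Y)"

definition affine_manifold ::
    "('m::{t2_space, second_countable_topology}, 'n::finite) chart set \<Rightarrow>
       (('m, 'n) vfield \<Rightarrow> ('m, 'n) vfield \<Rightarrow> ('m, 'n) vfield) \<Rightarrow> bool" where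
  "affine_manifold A nabla \<longleftrightarrow> smooth_manifold A \<and> connection A nabla \<and> torsion_free A nabla"

definition curvature ::
    "('m, 'n::finite) chart set \<Rightarrow> (('m, 'n) vfield \<Rightarrow> ('m, 'n) vfield \<Rightarrow> ('m, 'n) vfield) \<Rightarrow>
       ('m, 'n) vfield \<Rightarrow> ('m, 'n) vfield \<Rightarrow> ('m, 'n) vfield \<Rightarrow> ('m, 'n) vfield" where
  "curvature A nabla X Y Z =
     vf_diff (vf_diff (nabla X (nabla Y Z)) (nabla Y (nabla X Z))) (nabla (lie_bracket A X Y) Z)"

text \<open>The curvature is tensorial: its value at \<open>p\<close> depends only on the values at \<open>p\<close> of the three
  vector fields, so it acts on tangent vectors at \<open>p\<close>.\<close>

definition curvature_at ::
    "('m, 'n::finite) chart set \<Rightarrow> (('m, 'n) vfield \<Rightarrow> ('m, 'n) vfield \<Rightarrow> ('m, 'n) vfield) \<Rightarrow>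
       'm \<Rightarrow> ('m, 'n) tvec \<Rightarrow> ('m, 'n) tvec \<Rightarrow> ('m, 'n) tvec \<Rightarrow> ('m, 'n) tvec" where
  "curvature_at A nabla p x y z =
     (THE w. \<exists>X\<in>vfields A. \<exists>Y\<in>vfields A. \<exists>Z\<in>vfields A.
        X p = x \<and> Y p = y \<and> Z p = z \<and> w = curvature A nabla X Y Z p)"

definition jacobi ::
    "('m, 'n::finite) chart set \<Rightarrow> (('m, 'n) vfield \<Rightarrow> ('m, 'n) vfield \<Rightarrow> ('m, 'n) vfield) \<Rightarrow>
       ('m, 'n) tpoint \<Rightarrow> ('m, 'n) tvec \<Rightarrow> ('m, 'n) tvec" where
  "jacobi A nabla x = (\<lambda>y. curvature_at A nabla (fst x) y (snd x) (snd x))"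


section \<open>Trace and spectrum of an endomorphism of a tangent space\<close>

text \<open>Matrix of an endomorphism \<open>T\<close> of the tangent space at \<open>p\<close>, in a coordinate basis.\<close>

definition endo_matrix ::
    "('m, 'n::finite) chart set \<Rightarrow> 'm \<Rightarrow> (('m, 'n) tvec \<Rightarrow> ('m, 'n) tvec) \<Rightarrow> real ^ 'n ^ 'n" where
  "endo_matrix A p T = (let c = chart_at A p in matrix (\<lambda>u. T (tangent_of A c p u) c))"

definition Tr ::
    "('m, 'n::finite) chart set \<Rightarrow> 'm \<Rightarrow> (('m, 'n) tvec \<Rightarrow> ('m, 'n) tvec) \<Rightarrow> real" where
  "Tr A p T = trace (endo_matrix A p T)"

text \<open>The polynomial \<open>det (T - \<lambda> Id)\<close> in the variable \<open>\<lambda>\<close>, over the complex numbers.\<close>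

definition charpoly :: "real ^ 'n::finite ^ 'n \<Rightarrow> complex poly" where
  "charpoly B = det (map_matrix (\<lambda>b. [:complex_of_real b:]) B - mat [:0, 1:])"

definition Spec ::
    "('m, 'n::finite) chart set \<Rightarrow> 'm \<Rightarrow> (('m, 'n) tvec \<Rightarrow> ('m, 'n) tvec) \<Rightarrow> complex set" where
  "Spec A p T = {z. poly (charpoly (endo_matrix A p T)) z = 0}"

text \<open>The same roots listed with multiplicity. Identities between odd power traces need this
  version: the sets of eigenvalues \<open>{1, 1, -1}\<close> and \<open>{-1, -1, 1}\<close> agree, and each is \<open>-1\<close>
  times itself, but the traces are \<open>1\<close> and \<open>-1\<close>.\<close>

definition Spec_mset ::
    "('m, 'n::finite) chart set \<Rightarrow> 'm \<Rightarrow> (('m, 'n) tvec \<Rightarrow> ('m, 'n) tvec) \<Rightarrow> complex multiset" where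
  "Spec_mset A p T = proots (charpoly (endo_matrix A p T))"

end

theory Submission
  imports "Jordan_Normal_Form.Schur_Decomposition" Defs
begin

(* The dollar sign is kept for the components of vectors indexed by a finite type. *)
no_notation vec_index (infixl "$" 100)

text \<open>The proof has a geometric part, which turns the Jacobi operators into matrices depending smoothly
  on the point of the tangent bundle, and an algebraic part, which compares their eigenvalues.

  \<^bold>\<open>Geometry.\<close> The Jacobi operator is defined from the value of the curvature on arbitrary vector
  fields through the given tangent vectors, so everything rests on the curvature being a tensor. It
  is linear over the smooth functions in each argument: in the first two because, for a torsion-free
  connection, \<open>[X, Y] = \<nabla>\<^sub>X Y - \<nabla>\<^sub>Y X\<close> (this also shows that the bracket is again a vector field,
  without transforming second derivatives), and in the third because \<open>X(Yf) - Y(Xf) = [X, Y]f\<close>, which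
  is the symmetry of second derivatives. An operator that is linear over the smooth functions
  depends at a point only on the value of its argument there (\<open>tensorial_eq_at\<close>): multiply by a
  bump function and expand in the coordinate fields. The same expansion shows that the curvature has
  smooth components in every chart (\<open>curvature_components_exist\<close>). Hence in a bundle chart the
  Jacobi operator is given by a matrix with smooth entries (\<open>jacobi_matrix_smooth\<close>), and a change of
  chart conjugates this matrix, so the traces of its powers and its eigenvalues do not change.

  \<^bold>\<open>Algebra.\<close> Triangularising a complex matrix shows that the trace of its \<open>k\<close>-th power is the sum
  of the \<open>k\<close>-th powers of its eigenvalues (\<open>charpoly_roots_and_power_traces\<close>). This gives the first
  claim of the theorem at once. Conversely, a finite multiset of complex numbers is determined by its
  power sums (\<open>mset_eq_of_power_sums\<close>).

  \<^bold>\<open>The sign of \<open>s\<close>.\<close> Let \<open>\<rho>(x) > 0\<close> be the spectral radius of the Jacobi operator at \<open>x\<close>; comparing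
  spectral radii gives \<open>\<rho>(x) = \<bar>s(x, y)\<bar> \<rho>(y)\<close>. Every eigenvalue persists, approximately, under a small
  change of the matrix. Because the nonzero eigenvalues at \<open>x\<close> are those at \<open>y\<close> times one factor, this
  one-sided stability bounds the factor from both sides, and \<open>\<rho>\<close> is continuous
  (\<open>spectral_radius_tendsto\<close>). After division by \<open>\<rho>(x)\<close> the eigenvalues at \<open>x\<close> are those at a fixed
  point, divided by their spectral radius, up to a common sign and up to multiplicities: only
  finitely many multisets occur. Their power sums are continuous functions of \<open>x\<close> with finitely many
  values, hence constant on the connected set \<open>\<O>\<close>. So the normalized multiset is constant
  (\<open>normalized_eigs_constant\<close>), which says that the eigenvalues at \<open>x\<close> are those at \<open>y\<close> times
  \<open>\<rho>(x) / \<rho>(y) = \<bar>s(x, y)\<bar>\<close>, with multiplicities.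

  \<^bold>\<open>The root formula.\<close> Since some eigenvalue is not \<open>0\<close>, some power trace with \<open>k > 0\<close> is nonzero at
  one point of \<open>\<O>\<close>, hence at all points, and \<open>\<bar>s(x, y)\<bar>\<close> is the \<open>k\<close>-th root of a positive quotient of
  two smooth functions.\<close>

section \<open>Smooth maps\<close>

lemma C_k_on_cong:
  assumes "open S" "\<And>x. x \<in> S \<Longrightarrow> f x = g x" "C_k_on k S f"
  shows "C_k_on k S g"
  using assms(2,3)
proof (induction k arbitrary: f g)
  case 0
  then show ?case using continuous_on_cong by force
next
  case (Suc k)
  have d: "f differentiable (at x)" if "x \<in> S" for x using Suc.prems that by simp
  have eq: "frechet_derivative f (at x) = frechet_derivative g (at x)" if "x \<in> S" for x
    using frechet_derivative_transform_within_open[OF d[OF that] assms(1) that] Suc.prems(1) by blast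
  have "g differentiable (at x)" if "x \<in> S" for x
    using d[OF that] has_derivative_transform_within_open[OF _ assms(1) that] Suc.prems(1)
    unfolding differentiable_def by metis
  moreover have "C_k_on k S (\<lambda>x. frechet_derivative g (at x) v)" for v
    by (rule Suc.IH[of "\<lambda>x. frechet_derivative f (at x) v"]) (use eq Suc.prems in auto)
  ultimately show ?case by simp
qed

lemma C_k_on_subset: "C_k_on k S f \<Longrightarrow> T \<subseteq> S \<Longrightarrow> C_k_on k T f"
  by (induction k arbitrary: f) (auto intro: continuous_on_subset)

lemma C_k_on_continuous_on: "C_k_on k S f \<Longrightarrow> continuous_on S f"
  by (cases k) (auto intro!: continuous_at_imp_continuous_on differentiable_imp_continuous_within)

lemma C_k_on_SucD: "C_k_on (Suc k) S f \<Longrightarrow> C_k_on k S f"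
proof (induction k arbitrary: f)
  case 0 then show ?case using C_k_on_continuous_on C_k_on.simps(1) by blast
next
  case (Suc k)
  then show ?case by (subst C_k_on.simps) (simp only: C_k_on.simps(2), blast)
qed

lemma C_k_on_local:
  assumes "\<And>x. x \<in> S \<Longrightarrow> \<exists>U. open U \<and> x \<in> U \<and> C_k_on k U f"
  shows "C_k_on k S f"
  using assms
proof (induction k arbitrary: f)
  case 0
  then show ?case
    by (metis C_k_on.simps(1) continuous_at_imp_continuous_on continuous_on_eq_continuous_at)
next
  case (Suc k)
  have "C_k_on k S (\<lambda>x. frechet_derivative f (at x) v)" for v
    by (rule Suc.IH) (use Suc.prems in fastforce)
  moreover have "f differentiable (at x)" if "x \<in> S" for x
    using Suc.prems[OF that] by auto
  ultimately show ?case by simp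
qed

text \<open>To prove smoothness it is enough to exhibit the derivative as an explicit family; the induction
  over the order of differentiability then never touches \<open>frechet_derivative\<close> itself.\<close>

lemma C_k_on_SucI:
  assumes "open S" "\<And>x. x \<in> S \<Longrightarrow> (f has_derivative f' x) (at x)"
    "\<And>v. C_k_on k S (\<lambda>x. f' x v)"
  shows "C_k_on (Suc k) S f"
proof -
  have "C_k_on k S (\<lambda>x. frechet_derivative f (at x) v)" for v
    by (rule C_k_on_cong[OF assms(1) _ assms(3)[of v]])
       (use assms(2) frechet_derivative_at in metis)
  then show ?thesis using assms(2) by (auto simp: differentiable_def)
qed

lemma C_k_on_SucD_has_derivative:
  assumes "C_k_on (Suc k) S f" "x \<in> S"
  shows "(f has_derivative frechet_derivative f (at x)) (at x)"
  using assms frechet_derivative_works by auto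

lemma C_k_on_const: "open S \<Longrightarrow> C_k_on k S (\<lambda>x. c)"
  by (induction k arbitrary: c) (auto simp: frechet_derivative_const)

lemma C_k_on_bounded_linear:
  assumes "open S" "bounded_linear f" shows "C_k_on k S f"
proof (cases k)
  case 0 then show ?thesis using assms by (simp add: linear_continuous_on)
next
  case (Suc j)
  then show ?thesis
    using assms C_k_on_SucI[of S f "\<lambda>x. f"] C_k_on_const bounded_linear_imp_has_derivative by blast
qed

lemma C_k_on_add:
  assumes "open S" "C_k_on k S f" "C_k_on k S g"
  shows "C_k_on k S (\<lambda>x. f x + g x)"
  using assms(2,3)
proof (induction k arbitrary: f g)
  case 0 then show ?case by (simp add: continuous_on_add)
next
  case (Suc k)
  show ?case
    by (rule C_k_on_SucI[OF assms(1), where f' = "\<lambda>x v. frechet_derivative f (at x) v + frechet_derivative g (at x) v"])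
       (use Suc.prems in \<open>auto intro!: has_derivative_add C_k_on_SucD_has_derivative Suc.IH\<close>)
qed

lemma C_k_on_bounded_bilinear:
  assumes "bounded_bilinear prd" "open S" "C_k_on k S f" "C_k_on k S g"
  shows "C_k_on k S (\<lambda>x. prd (f x) (g x))"
  using assms(3,4)
proof (induction k arbitrary: f g)
  case 0 then show ?case using bounded_bilinear.continuous_on[OF assms(1)] by simp
next
  case (Suc k)
  show ?case
  proof (rule C_k_on_SucI[OF assms(2)])
    show "((\<lambda>x. prd (f x) (g x)) has_derivative
       (\<lambda>v. prd (f x) (frechet_derivative g (at x) v) + prd (frechet_derivative f (at x) v) (g x))) (at x)"
      if "x \<in> S" for x
      using bounded_bilinear.FDERIV[OF assms(1) C_k_on_SucD_has_derivative[OF Suc.prems(1) that]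
          C_k_on_SucD_has_derivative[OF Suc.prems(2) that]] .
    show "C_k_on k S (\<lambda>x. prd (f x) (frechet_derivative g (at x) v) + prd (frechet_derivative f (at x) v) (g x))" for v
      using Suc.prems C_k_on_SucD[OF Suc.prems(1)] C_k_on_SucD[OF Suc.prems(2)]
      by (intro C_k_on_add[OF assms(2)] Suc.IH) auto
  qed
qed

lemma C_k_on_sum:
  assumes "open S" "\<And>i. i \<in> I \<Longrightarrow> C_k_on k S (f i)"
  shows "C_k_on k S (\<lambda>x. \<Sum>i\<in>I. f i x)"
  using assms(2)
  by (induction I rule: infinite_finite_induct) (auto intro: C_k_on_const C_k_on_add assms(1))

lemma linear_Basis_expansion:
  assumes "linear f" shows "f v = (\<Sum>b\<in>Basis. (v \<bullet> b) *\<^sub>R f b)"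
  by (metis (no_types, lifting) assms euclidean_representation linear_scale linear_sum sum.cong)

text \<open>In coordinates the chain rule reads \<open>\<Sum>\<^sub>b (Df(x)v)\<^sub>b \<partial>\<^sub>b g(f x)\<close>, which reduces the order by one: each
  factor \<open>\<partial>\<^sub>b g \<circ> f\<close> is covered by the induction hypothesis, as \<open>g\<close> is arbitrary there.\<close>

lemma C_k_on_compose:
  assumes "open S" "open T" "C_k_on k S f" "C_k_on k T g" "f ` S \<subseteq> T"
  shows "C_k_on k S (\<lambda>x. g (f x))"
  using assms(3,4)
proof (induction k arbitrary: g)
  case 0 then show ?case using continuous_on_compose2 assms(5) by auto
next
  case (Suc k)
  have fk: "C_k_on k S f" using Suc.prems C_k_on_SucD by blast
  let ?G = "\<lambda>x. frechet_derivative g (at (f x))"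
  have D: "(g has_derivative ?G x) (at (f x))" if "x \<in> S" for x
    using that assms(5) Suc.prems(2) by (intro C_k_on_SucD_has_derivative) auto
  show ?case
  proof (rule C_k_on_SucI[OF assms(1)])
    fix x assume x: "x \<in> S"
    show "((\<lambda>x. g (f x)) has_derivative (\<lambda>v. \<Sum>b\<in>Basis. (frechet_derivative f (at x) v \<bullet> b) *\<^sub>R ?G x b)) (at x)"
      using diff_chain_at[OF C_k_on_SucD_has_derivative[OF Suc.prems(1) x] D[OF x]]
      unfolding o_def by (subst linear_Basis_expansion[OF has_derivative_linear[OF D[OF x]], symmetric])
  next
    fix v
    show "C_k_on k S (\<lambda>x. \<Sum>b\<in>Basis. (frechet_derivative f (at x) v \<bullet> b) *\<^sub>R ?G x b)"
      using Suc.prems fk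
      by (intro C_k_on_sum assms(1) C_k_on_bounded_bilinear[OF bounded_bilinear_scaleR]
          C_k_on_bounded_bilinear[OF bounded_bilinear_inner] C_k_on_const Suc.IH) auto
  qed
qed

lemma C_k_on_exp: "C_k_on k UNIV (exp :: real \<Rightarrow> real)"
proof (induction k)
  case (Suc k)
  show ?case
    by (rule C_k_on_SucI[where f' = "\<lambda>x v. v * exp x"])
       (use Suc in \<open>auto intro!: derivative_eq_intros C_k_on_bounded_bilinear[OF bounded_bilinear_mult] C_k_on_const\<close>)
qed (simp add: continuous_on_exp)

lemma C_k_on_inverse: "C_k_on k (- {0}) (inverse :: real \<Rightarrow> real)"
proof (induction k)
  case (Suc k)
  show ?case
  proof (rule C_k_on_SucI)
    show "(inverse has_derivative (\<lambda>v. - v * (inverse x * inverse x))) (at x)" if "x \<in> - {0}" for x :: real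
      using that by (auto intro!: derivative_eq_intros simp: power2_eq_square)
    show "C_k_on k (- {0}) (\<lambda>x. - v * (inverse x * inverse x))" for v :: real
      by (intro C_k_on_bounded_bilinear[OF bounded_bilinear_mult] C_k_on_const Suc) auto
  qed auto
qed (simp add: continuous_on_inverse)

lemma C_k_on_ln: "C_k_on k {0<..} (ln :: real \<Rightarrow> real)"
proof (cases k)
  case (Suc j)
  have inv: "C_k_on j {0<..} (inverse :: real \<Rightarrow> real)"
    by (rule C_k_on_subset[OF C_k_on_inverse]) auto
  show ?thesis unfolding Suc
  proof (intro C_k_on_SucI)
    show "(ln has_derivative (\<lambda>v. v * inverse x)) (at x)" if "x \<in> {0<..}" for x :: real
      using that by (auto intro!: derivative_eq_intros simp: divide_simps)
    show "C_k_on j {0<..} (\<lambda>x. v * inverse x)" for v :: real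
      using inv by (intro C_k_on_bounded_bilinear[OF bounded_bilinear_mult] C_k_on_const) auto
  qed auto
qed (auto intro!: continuous_at_imp_continuous_on isCont_ln)

lemma smooth_on_cong: "open S \<Longrightarrow> (\<And>x. x \<in> S \<Longrightarrow> f x = g x) \<Longrightarrow> smooth_on S f \<Longrightarrow> smooth_on S g"
  unfolding smooth_on_def by (intro allI C_k_on_cong[of S f g]) auto

lemma smooth_on_subset: "smooth_on S f \<Longrightarrow> T \<subseteq> S \<Longrightarrow> smooth_on T f"
  unfolding smooth_on_def by (blast intro: C_k_on_subset)

lemma smooth_on_local:
  "(\<And>x. x \<in> S \<Longrightarrow> \<exists>U. open U \<and> x \<in> U \<and> smooth_on U f) \<Longrightarrow> smooth_on S f"
  unfolding smooth_on_def by (intro allI C_k_on_local) blast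

lemma smooth_on_continuous_on: "smooth_on S f \<Longrightarrow> continuous_on S f"
  unfolding smooth_on_def by (rule C_k_on_continuous_on[of 0]) simp

lemma smooth_on_has_derivative:
  "smooth_on S f \<Longrightarrow> x \<in> S \<Longrightarrow> (f has_derivative frechet_derivative f (at x)) (at x)"
  unfolding smooth_on_def by (intro C_k_on_SucD_has_derivative[of 0 S]) simp_all

lemma smooth_on_frechet_derivative:
  "smooth_on S f \<Longrightarrow> smooth_on S (\<lambda>x. frechet_derivative f (at x) v)"
  unfolding smooth_on_def by (metis C_k_on.simps(2))

lemma smooth_on_const: "open S \<Longrightarrow> smooth_on S (\<lambda>x. c)"
  unfolding smooth_on_def by (intro allI, rule C_k_on_const[of S]) simp_all

lemma smooth_on_bounded_linear: "open S \<Longrightarrow> bounded_linear f \<Longrightarrow> smooth_on S f"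
  unfolding smooth_on_def by (intro allI, rule C_k_on_bounded_linear[of S f]) simp_all

lemma smooth_on_add: "open S \<Longrightarrow> smooth_on S f \<Longrightarrow> smooth_on S g \<Longrightarrow> smooth_on S (\<lambda>x. f x + g x)"
  unfolding smooth_on_def by (intro allI, rule C_k_on_add[of S _ f g]) simp_all

lemma smooth_on_sum: "open S \<Longrightarrow> (\<And>i. i \<in> I \<Longrightarrow> smooth_on S (f i)) \<Longrightarrow> smooth_on S (\<lambda>x. \<Sum>i\<in>I. f i x)"
  unfolding smooth_on_def by (intro allI, rule C_k_on_sum[of S I]) simp_all

lemma smooth_on_bounded_bilinear:
  "bounded_bilinear prd \<Longrightarrow> open S \<Longrightarrow> smooth_on S f \<Longrightarrow> smooth_on S g \<Longrightarrow> smooth_on S (\<lambda>x. prd (f x) (g x))"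
  unfolding smooth_on_def by (intro allI, rule C_k_on_bounded_bilinear[of prd S _ f g]) simp_all

lemmas smooth_on_scaleR = smooth_on_bounded_bilinear[OF bounded_bilinear_scaleR]
lemmas smooth_on_mult = smooth_on_bounded_bilinear[OF bounded_bilinear_mult, of _ "f :: _ \<Rightarrow> real" for f]
lemmas smooth_on_inner = smooth_on_bounded_bilinear[OF bounded_bilinear_inner]

lemma smooth_on_compose:
  "open S \<Longrightarrow> open T \<Longrightarrow> smooth_on S f \<Longrightarrow> smooth_on T g \<Longrightarrow> f ` S \<subseteq> T \<Longrightarrow> smooth_on S (\<lambda>x. g (f x))"
  unfolding smooth_on_def by (intro allI, rule C_k_on_compose[of S T _ f g]) simp_all

lemma smooth_on_bounded_linear_compose:
  "open S \<Longrightarrow> bounded_linear L \<Longrightarrow> smooth_on S f \<Longrightarrow> smooth_on S (\<lambda>x. L (f x))"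
  by (rule smooth_on_compose[of S UNIV f L]) (simp_all add: smooth_on_bounded_linear)

lemma smooth_on_diff: "open S \<Longrightarrow> smooth_on S f \<Longrightarrow> smooth_on S g \<Longrightarrow> smooth_on S (\<lambda>x. f x - g x)"
  using smooth_on_add[of S f "\<lambda>x. - g x"] smooth_on_bounded_linear_compose[of S uminus g]
  by (simp add: bounded_linear_minus[OF bounded_linear_ident])

lemma smooth_on_inverse:
  "open S \<Longrightarrow> smooth_on S f \<Longrightarrow> (\<And>x. x \<in> S \<Longrightarrow> f x \<noteq> (0::real)) \<Longrightarrow> smooth_on S (\<lambda>x. inverse (f x))"
  by (rule smooth_on_compose[of S "- {0}" f inverse]) (auto simp: smooth_on_def C_k_on_inverse)

text \<open>Away from \<open>0\<close> the root is \<open>exp (ln t / k)\<close>, a composition of maps whose smoothness is known.\<close>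

lemma smooth_on_root:
  assumes "open S" "smooth_on S f" "\<And>x. x \<in> S \<Longrightarrow> f x > 0" "k > 0"
  shows "smooth_on S (\<lambda>x. root k (f x))"
proof -
  have ln: "smooth_on S (\<lambda>x. ln (f x))"
    by (rule smooth_on_compose[of S "{0<..}" f ln]) (use assms in \<open>auto simp: smooth_on_def C_k_on_ln\<close>)
  have "smooth_on S (\<lambda>x. exp (inverse (real k) * ln (f x)))"
  proof (rule smooth_on_compose[of S UNIV _ exp])
    show "smooth_on S (\<lambda>x. inverse (real k) * ln (f x))"
      by (intro smooth_on_mult smooth_on_const assms(1) ln)
  qed (use assms in \<open>auto simp: smooth_on_def C_k_on_exp\<close>)
  then show ?thesis
    by (rule smooth_on_cong[OF assms(1), rotated]) (use assms(3,4) in \<open>subst root_powr_inverse, auto simp: powr_def divide_inverse less_imp_le less_imp_neq[symmetric]\<close>)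
qed

lemma smooth_on_vec_iff:
  fixes f :: "'a::euclidean_space \<Rightarrow> real ^ 'n::finite"
  assumes "open S"
  shows "smooth_on S f \<longleftrightarrow> (\<forall>i. smooth_on S (\<lambda>x. f x $ i))"
proof
  assume "smooth_on S f"
  then show "\<forall>i. smooth_on S (\<lambda>x. f x $ i)"
    using smooth_on_bounded_linear_compose[OF assms bounded_linear_vec_nth] by blast
next
  assume *: "\<forall>i. smooth_on S (\<lambda>x. f x $ i)"
  have "smooth_on S (\<lambda>x. \<Sum>i\<in>UNIV. f x $ i *\<^sub>R (axis i 1 :: real ^ 'n))"
    using * by (intro smooth_on_sum assms smooth_on_scaleR smooth_on_const) auto
  moreover have "(\<Sum>i\<in>UNIV. y $ i *\<^sub>R axis i 1) = y" for y :: "real ^ 'n"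
    using basis_expansion[of y] by (simp add: scalar_mult_eq_scaleR)
  ultimately show "smooth_on S f" by (simp only:)
qed

section \<open>A smooth bump function\<close>

lemma poly_times_power_div_exp_tendsto_0:
  "((\<lambda>u. poly p u * u ^ k / exp u) \<longlongrightarrow> (0::real)) at_top"
proof (induction p arbitrary: k)
  case 0 then show ?case by simp
next
  case (pCons a p)
  have "((\<lambda>u. a * (u ^ k / exp u) + poly p u * u ^ Suc k / exp u) \<longlongrightarrow> a * 0 + 0) at_top"
    by (intro tendsto_intros tendsto_power_div_exp_0 pCons)
  then show ?case by (simp add: algebra_simps add_divide_distrib)
qed

text \<open>The family \<open>p(1/t) exp(-1/t)\<close>, extended by \<open>0\<close> to \<open>t \<le> 0\<close>, with an arbitrary polynomial \<open>p\<close>: unlike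
  \<open>exp(-1/t)\<close> alone it is closed under differentiation.\<close>

definition flat_exp :: "real poly \<Rightarrow> real \<Rightarrow> real" where
  "flat_exp p t = (if t > 0 then poly p (inverse t) * exp (- inverse t) else 0)"

text \<open>For \<open>t > 0\<close> the factor \<open>1/t\<^sup>2\<close> from the chain rule becomes the polynomial factor \<open>[:0, 0, 1:]\<close>. At
  \<open>t = 0\<close> the difference quotient from the right is \<open>u p(u) exp(-u)\<close> with \<open>u = 1/t\<close>, which tends to \<open>0\<close>
  because the exponential outgrows every polynomial.\<close>

lemma flat_exp_has_derivative:
  "(flat_exp p has_real_derivative flat_exp ([:0, 0, 1:] * (p - pderiv p)) t) (at t)"
proof (cases t "0 :: real" rule: linorder_cases)
  case less
  have "((\<lambda>t. 0) has_real_derivative 0) (at t)" by simp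
  then have "(flat_exp p has_real_derivative 0) (at t)"
    by (rule DERIV_cong_ev[THEN iffD1, rotated 3, OF _])
       (use less in \<open>auto simp: flat_exp_def eventually_nhds intro!: exI[of _ "{..<0}"]\<close>)
  then show ?thesis using less by (simp add: flat_exp_def)
next
  case greater
  have "((\<lambda>t. poly p (inverse t) * exp (- inverse t)) has_real_derivative
      poly p (inverse t) * (exp (- inverse t) * (inverse t * inverse t))
      + poly (pderiv p) (inverse t) * (- (inverse t * inverse t)) * exp (- inverse t)) (at t)"
    using greater by (auto intro!: derivative_eq_intros DERIV_chain2[OF poly_DERIV] simp: field_simps power2_eq_square)
  then have "(flat_exp p has_real_derivative
      poly p (inverse t) * (exp (- inverse t) * (inverse t * inverse t))
      + poly (pderiv p) (inverse t) * (- (inverse t * inverse t)) * exp (- inverse t)) (at t)"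
    by (rule DERIV_cong_ev[THEN iffD1, rotated 3, OF _])
       (use greater in \<open>auto simp: flat_exp_def eventually_nhds intro!: exI[of _ "{0<..}"]\<close>)
  then show ?thesis using greater by (simp add: flat_exp_def algebra_simps)
next
  case equal
  have "((\<lambda>h. flat_exp p h / h) \<longlongrightarrow> 0) (at_right 0)"
  proof (rule Lim_transform_eventually)
    show "((\<lambda>h. poly p (inverse h) * inverse h ^ 1 / exp (inverse h)) \<longlongrightarrow> 0) (at_right (0::real))"
      by (rule filterlim_compose[OF poly_times_power_div_exp_tendsto_0 filterlim_inverse_at_top_right])
    show "\<forall>\<^sub>F h in at_right 0. poly p (inverse h) * inverse h ^ 1 / exp (inverse h) = flat_exp p h / h"
      using eventually_at_right_less[of "0::real"]
      by eventually_elim (simp add: flat_exp_def exp_minus divide_inverse)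
  qed
  moreover have "((\<lambda>h. flat_exp p h / h) \<longlongrightarrow> 0) (at_left 0)"
    by (rule tendsto_eventually) (auto simp: flat_exp_def eventually_at_filter)
  ultimately have "((\<lambda>h. flat_exp p h / h) \<longlongrightarrow> 0) (at 0)"
    by (simp add: filterlim_split_at)
  then have "(flat_exp p has_real_derivative 0) (at 0)"
    unfolding DERIV_def by (simp add: flat_exp_def[of p 0])
  then show ?thesis using equal by (simp add: flat_exp_def)
qed

lemma smooth_on_flat_exp: "smooth_on UNIV (flat_exp p)"
proof -
  have "C_k_on k UNIV (flat_exp p)" for k
  proof (induction k arbitrary: p)
    case 0
    show ?case using flat_exp_has_derivative DERIV_continuous_on
      by (metis C_k_on.simps(1) DERIV_subset top_greatest)
  next
    case (Suc k)
    show ?case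
      by (rule C_k_on_SucI[where f' = "\<lambda>t v. flat_exp ([:0, 0, 1:] * (p - pderiv p)) t * v"])
         (use flat_exp_has_derivative in \<open>auto simp: has_field_derivative_def
            intro!: Suc.IH C_k_on_bounded_bilinear[OF bounded_bilinear_mult] C_k_on_const\<close>)
  qed
  then show ?thesis by (simp add: smooth_on_def)
qed

text \<open>The function vanishes exactly off the open ball, where its argument \<open>r\<^sup>2 - |x - a|\<^sup>2\<close> is not positive.\<close>

lemma smooth_bump_exists:
  fixes a :: "'a::euclidean_space"
  assumes "r > 0"
  obtains \<phi> :: "'a \<Rightarrow> real"
  where "smooth_on UNIV \<phi>" "\<phi> a = 1" "\<And>x. \<phi> x \<noteq> 0 \<longleftrightarrow> x \<in> ball a r"
proof
  let ?q = "\<lambda>x. r\<^sup>2 - (x - a) \<bullet> (x - a)"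
  let ?\<phi> = "\<lambda>x. exp (inverse (r\<^sup>2)) * flat_exp 1 (?q x)"
  have "smooth_on UNIV ?q"
    by (intro smooth_on_diff smooth_on_inner smooth_on_const smooth_on_bounded_linear) auto
  then show "smooth_on UNIV ?\<phi>"
    by (intro smooth_on_mult smooth_on_const smooth_on_compose[OF _ _ _ smooth_on_flat_exp]) auto
  show "?\<phi> a = 1" using assms by (simp add: flat_exp_def exp_minus)
  show "?\<phi> x \<noteq> 0 \<longleftrightarrow> x \<in> ball a r" for x
    using assms by (auto simp: flat_exp_def dist_norm norm_minus_commute power2_norm_eq_inner[symmetric]
        abs_le_square_iff[symmetric] power_strict_mono not_less intro: power2_le_imp_le power2_less_imp_less)
qed

section \<open>Second derivatives\<close>

text \<open>The second difference of \<open>f\<close> over a small parallelogram, written as a mixed second derivative by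
  applying the mean value theorem first in direction \<open>v\<close> and then in direction \<open>w\<close>.\<close>

lemma second_difference_mean_value:
  fixes f :: "'a::euclidean_space \<Rightarrow> real"
  assumes f: "C_k_on 2 S f" and S: "ball x \<delta> \<subseteq> S" and h: "0 < h" "h * (norm v + norm w) < \<delta>"
  obtains \<xi> \<eta> where "0 < \<xi>" "\<xi> < h" "0 < \<eta>" "\<eta> < h"
    "f (x + h *\<^sub>R v + h *\<^sub>R w) - f (x + h *\<^sub>R v) - f (x + h *\<^sub>R w) + f x
       = h * h * frechet_derivative (\<lambda>y. frechet_derivative f (at y) v) (at (x + \<xi> *\<^sub>R v + \<eta> *\<^sub>R w)) w"
proof -
  have inS: "x + s *\<^sub>R v + t *\<^sub>R w \<in> S" if "0 \<le> s" "s \<le> h" "0 \<le> t" "t \<le> h" for s t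
  proof -
    have "norm (s *\<^sub>R v + t *\<^sub>R w) \<le> s * norm v + t * norm w"
      using that norm_triangle_ineq[of "s *\<^sub>R v" "t *\<^sub>R w"] by simp
    also have "\<dots> \<le> h * norm v + h * norm w"
      using that by (intro add_mono mult_right_mono) auto
    also have "\<dots> < \<delta>" using h by (simp add: algebra_simps)
    finally have "dist (x + (s *\<^sub>R v + t *\<^sub>R w)) x < \<delta>"
      by (simp add: dist_norm)
    then have "x + (s *\<^sub>R v + t *\<^sub>R w) \<in> ball x \<delta>"
      by (simp add: dist_commute)
    then show ?thesis using S by (auto simp: add.assoc)
  qed
  have Df: "(f has_derivative frechet_derivative f (at y)) (at y)" if "y \<in> S" for y
    using f that by (intro C_k_on_SucD_has_derivative[of 1]) (simp_all add: numeral_2_eq_2)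
  have DDf: "((\<lambda>y. frechet_derivative f (at y) v) has_derivative
      frechet_derivative (\<lambda>y. frechet_derivative f (at y) v) (at y)) (at y)" if "y \<in> S" for y
    using f that by (intro C_k_on_SucD_has_derivative[of 0]) (simp_all add: numeral_2_eq_2)
  have along: "((\<lambda>s. g (z + s *\<^sub>R u)) has_real_derivative g' u) (at s)"
    if "(g has_derivative g') (at (z + s *\<^sub>R u))" for g g' and z u :: 'a and s
  proof -
    have "((\<lambda>s. g (z + s *\<^sub>R u)) has_derivative (\<lambda>t. g' (t *\<^sub>R u))) (at s)"
      by (rule has_derivative_compose[of "\<lambda>s. z + s *\<^sub>R u" _ s UNIV g g'])
         (auto intro!: derivative_eq_intros that)
    then show ?thesis
      using linear_scale[OF has_derivative_linear[OF that]]
      by (simp add: has_field_derivative_def mult.commute[of _ "g' u"])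
  qed
  let ?\<phi> = "\<lambda>s. f (x + h *\<^sub>R w + s *\<^sub>R v) - f (x + s *\<^sub>R v)"
  let ?\<phi>' = "\<lambda>s. frechet_derivative f (at (x + h *\<^sub>R w + s *\<^sub>R v)) v - frechet_derivative f (at (x + s *\<^sub>R v)) v"
  have "(?\<phi> has_real_derivative ?\<phi>' s) (at s)" if "0 \<le> s" "s \<le> h" for s
    using inS[of s h] inS[of s 0] that h
    by (intro DERIV_diff along Df) (auto simp: algebra_simps)
  then obtain \<xi> where \<xi>: "0 < \<xi>" "\<xi> < h" "?\<phi> h - ?\<phi> 0 = (h - 0) * ?\<phi>' \<xi>"
    using MVT2[of 0 h ?\<phi> ?\<phi>'] h by auto
  let ?\<psi> = "\<lambda>t. frechet_derivative f (at (x + \<xi> *\<^sub>R v + t *\<^sub>R w)) v"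
  let ?\<psi>' = "\<lambda>t. frechet_derivative (\<lambda>y. frechet_derivative f (at y) v) (at (x + \<xi> *\<^sub>R v + t *\<^sub>R w)) w"
  have "(?\<psi> has_real_derivative ?\<psi>' t) (at t)" if "0 \<le> t" "t \<le> h" for t
    using inS[of \<xi> t] that \<xi> by (intro along[where g = "\<lambda>y. frechet_derivative f (at y) v"] DDf) auto
  then obtain \<eta> where \<eta>: "0 < \<eta>" "\<eta> < h" "?\<psi> h - ?\<psi> 0 = (h - 0) * ?\<psi>' \<eta>"
    using MVT2[of 0 h ?\<psi> ?\<psi>'] h by auto
  have "?\<phi>' \<xi> = ?\<psi> h - ?\<psi> 0" by (simp add: algebra_simps)
  then have "?\<phi> h - ?\<phi> 0 = h * h * ?\<psi>' \<eta>" using \<xi> \<eta> by simp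
  then show ?thesis using that[OF \<xi>(1,2) \<eta>(1,2)] by (simp add: algebra_simps)
qed

text \<open>The second difference does not change when \<open>v\<close> and \<open>w\<close> are exchanged, so at points arbitrarily close to
  \<open>x\<close> the two mixed derivatives agree, and both are continuous.\<close>

lemma second_derivative_symmetric:
  fixes f :: "'a::euclidean_space \<Rightarrow> real"
  assumes "open S" "C_k_on 2 S f" "x \<in> S"
  shows "frechet_derivative (\<lambda>y. frechet_derivative f (at y) v) (at x) w
       = frechet_derivative (\<lambda>y. frechet_derivative f (at y) w) (at x) v"
proof (rule ccontr)
  let ?D = "\<lambda>v w y. frechet_derivative (\<lambda>y. frechet_derivative f (at y) v) (at y) w"
  assume neq: "?D v w x \<noteq> ?D w v x"
  define e where "e = \<bar>?D v w x - ?D w v x\<bar> / 2"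
  have e: "e > 0" using neq by (simp add: e_def)
  have cont: "isCont (?D v w) x" for v w
  proof -
    have "continuous_on S (?D v w)" using assms(2) by (simp add: numeral_2_eq_2)
    then show ?thesis using assms by (simp add: continuous_on_eq_continuous_at)
  qed
  obtain d1 where d1: "d1 > 0" "\<And>y. dist y x < d1 \<Longrightarrow> dist (?D v w y) (?D v w x) < e"
    using cont[of v w] e unfolding continuous_at_eps_delta by metis
  obtain d2 where d2: "d2 > 0" "\<And>y. dist y x < d2 \<Longrightarrow> dist (?D w v y) (?D w v x) < e"
    using cont[of w v] e unfolding continuous_at_eps_delta by metis
  obtain d3 where d3: "d3 > 0" "ball x d3 \<subseteq> S" using assms openE by blast
  define d where "d = min d1 (min d2 d3)"
  have d: "d > 0" "d \<le> d1" "d \<le> d2" "ball x d \<subseteq> S" using d1 d2 d3 by (auto simp: d_def)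
  \<comment> \<open>the denominator is positive even if both directions vanish, and the parallelogram stays inside the ball\<close>
  define h where "h = d / (norm v + norm w + 1)"
  have pos: "norm v + norm w + 1 > 0" by (smt (verit) norm_ge_zero)
  then have h: "h > 0" "h * (norm v + norm w) < d"
    using d by (auto simp: h_def divide_simps) 
  have near: "dist (x + s *\<^sub>R v + t *\<^sub>R w) x < d" if "0 < s" "s < h" "0 < t" "t < h" for s t
  proof -
    have "norm (s *\<^sub>R v + t *\<^sub>R w) \<le> s * norm v + t * norm w"
      using that norm_triangle_ineq[of "s *\<^sub>R v" "t *\<^sub>R w"] by simp
    also have "\<dots> \<le> h * norm v + h * norm w"
      using that by (intro add_mono mult_right_mono) auto
    finally show ?thesis using h by (simp add: dist_norm algebra_simps)
  qed
  obtain s t where st: "0 < s" "s < h" "0 < t" "t < h"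
    "f (x + h *\<^sub>R v + h *\<^sub>R w) - f (x + h *\<^sub>R v) - f (x + h *\<^sub>R w) + f x = h * h * ?D v w (x + s *\<^sub>R v + t *\<^sub>R w)"
    using second_difference_mean_value[OF assms(2) d(4) h] .
  obtain t' s' where st': "0 < t'" "t' < h" "0 < s'" "s' < h"
    "f (x + h *\<^sub>R w + h *\<^sub>R v) - f (x + h *\<^sub>R w) - f (x + h *\<^sub>R v) + f x = h * h * ?D w v (x + t' *\<^sub>R w + s' *\<^sub>R v)"
    using second_difference_mean_value[OF assms(2) d(4) h(1), of w v] h(2) by (metis add.commute)
  have "?D v w (x + s *\<^sub>R v + t *\<^sub>R w) = ?D w v (x + s' *\<^sub>R v + t' *\<^sub>R w)"
    using st(5) st'(5) h(1) by (simp add: algebra_simps)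
  moreover have "dist (?D v w (x + s *\<^sub>R v + t *\<^sub>R w)) (?D v w x) < e"
    using near[OF st(1-4)] d by (intro d1) simp
  moreover have "dist (?D w v (x + s' *\<^sub>R v + t' *\<^sub>R w)) (?D w v x) < e"
    using near[OF st'(3,4,1,2)] d by (intro d2) simp
  ultimately have "\<bar>?D v w x - ?D w v x\<bar> < 2 * e" by (simp add: dist_real_def abs_if split: if_splits)
  then show False by (simp add: e_def)
qed

text \<open>The product rule for \<open>y \<mapsto> DF(y)(W(y))\<close>, the coordinate expression of the derivative of a function
  along a vector field; the field \<open>W\<close> is frozen in the second summand.\<close>

lemma has_derivative_frechet_derivative_along:
  fixes F :: "'a::euclidean_space \<Rightarrow> real"
  assumes "open S" "smooth_on S F" "smooth_on S W" "u \<in> S"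
  shows "((\<lambda>y. frechet_derivative F (at y) (W y)) has_derivative
      (\<lambda>h. frechet_derivative F (at u) (frechet_derivative W (at u) h)
         + frechet_derivative (\<lambda>y. frechet_derivative F (at y) (W u)) (at u) h)) (at u)"
proof -
  let ?F = "\<lambda>y. frechet_derivative F (at y)"
  have lin: "linear (?F y)" if "y \<in> S" for y
    using smooth_on_has_derivative[OF assms(2) that] has_derivative_linear by blast
  have expand: "?F y v = (\<Sum>b\<in>Basis. (v \<bullet> b) *\<^sub>R ?F y b)" if "y \<in> S" for y v
    by (rule linear_Basis_expansion[OF lin[OF that]])
  have DF: "((\<lambda>y. ?F y b) has_derivative frechet_derivative (\<lambda>y. ?F y b) (at u)) (at u)" for b
    by (intro smooth_on_has_derivative[OF _ assms(4)] smooth_on_frechet_derivative assms(2))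
  note DW = smooth_on_has_derivative[OF assms(3,4)]
  have "((\<lambda>y. \<Sum>b\<in>Basis. (W y \<bullet> b) *\<^sub>R ?F y b) has_derivative
      (\<lambda>h. \<Sum>b\<in>Basis. (W u \<bullet> b) *\<^sub>R frechet_derivative (\<lambda>y. ?F y b) (at u) h
          + (frechet_derivative W (at u) h \<bullet> b) *\<^sub>R ?F u b)) (at u)"
    by (intro has_derivative_sum has_derivative_scaleR has_derivative_inner_left DW DF)
  moreover have "((\<lambda>y. \<Sum>b\<in>Basis. (W u \<bullet> b) *\<^sub>R ?F y b) has_derivative
      (\<lambda>h. \<Sum>b\<in>Basis. (W u \<bullet> b) *\<^sub>R frechet_derivative (\<lambda>y. ?F y b) (at u) h)) (at u)"
    by (intro has_derivative_sum has_derivative_scaleR_right DF)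
  then have "((\<lambda>y. ?F y (W u)) has_derivative
      (\<lambda>h. \<Sum>b\<in>Basis. (W u \<bullet> b) *\<^sub>R frechet_derivative (\<lambda>y. ?F y b) (at u) h)) (at u)"
    by (rule has_derivative_transform_within_open[OF _ assms(1,4)])
       (rule expand[symmetric])
  then have "frechet_derivative (\<lambda>y. ?F y (W u)) (at u)
      = (\<lambda>h. \<Sum>b\<in>Basis. (W u \<bullet> b) *\<^sub>R frechet_derivative (\<lambda>y. ?F y b) (at u) h)"
    by (rule frechet_derivative_at[symmetric])
  ultimately have "((\<lambda>y. \<Sum>b\<in>Basis. (W y \<bullet> b) *\<^sub>R ?F y b) has_derivative
      (\<lambda>h. ?F u (frechet_derivative W (at u) h) + frechet_derivative (\<lambda>y. ?F y (W u)) (at u) h)) (at u)"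
    by (simp only: expand[OF assms(4), of "frechet_derivative W (at u) h" for h] sum.distrib) (simp add: add.commute)
  then show ?thesis
    by (rule has_derivative_transform_within_open[OF _ assms(1,4)])
       (rule expand[symmetric])
qed

section \<open>Characteristic polynomials and traces of powers\<close>

definition matpow :: "'a::semiring_1 ^ 'n ^ 'n \<Rightarrow> nat \<Rightarrow> 'a ^ 'n::finite ^ 'n" where
  "matpow B k = ((**) B ^^ k) (Finite_Cartesian_Product.mat 1)"

lemma matpow_simps [simp]: "matpow B 0 = Finite_Cartesian_Product.mat 1" "matpow B (Suc k) = B ** matpow B k"
  by (simp_all add: matpow_def)

lemma matpow_Suc_right: "matpow B (Suc k) = matpow B k ** B"
  by (induction k) (simp_all add: matrix_mul_assoc)

text \<open>A matrix indexed by a finite type, rewritten with numerical indices through an enumeration \<open>f\<close> of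
  the type. This transports the Schur decomposition, which is by induction on the size.\<close>

definition list_matrix :: "(nat \<Rightarrow> 'n) \<Rightarrow> 'a ^ 'n::finite ^ 'n \<Rightarrow> 'a Matrix.mat" where
  "list_matrix f B = Matrix.mat CARD('n) CARD('n) (\<lambda>(i, j). B $ f i $ f j)"

lemma list_matrix_carrier [simp]:
  fixes B :: "'a ^ 'n::finite ^ 'n"
  shows "list_matrix f B \<in> carrier_mat CARD('n) CARD('n)"
  by (simp add: list_matrix_def)

lemma list_matrix_mult:
  fixes B C :: "'a::comm_ring_1 ^ 'n::finite ^ 'n"
  assumes f: "bij_betw f {0..<CARD('n)} UNIV"
  shows "list_matrix f (B ** C) = list_matrix f B * list_matrix f C"
proof (rule eq_matI)
  fix i j assume "i < dim_row (list_matrix f B * list_matrix f C)" "j < dim_col (list_matrix f B * list_matrix f C)"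
  then have ij: "i < CARD('n)" "j < CARD('n)" by (auto simp: list_matrix_def)
  have "(\<Sum>k\<in>UNIV. B $ f i $ k * C $ k $ f j) = (\<Sum>k\<in>{0..<CARD('n)}. B $ f i $ f k * C $ f k $ f j)"
    by (rule sum.reindex_bij_betw[OF f, symmetric])
  then show "list_matrix f (B ** C) $$ (i, j) = (list_matrix f B * list_matrix f C) $$ (i, j)"
    using ij by (simp add: list_matrix_def matrix_matrix_mult_def scalar_prod_def)
qed (auto simp: list_matrix_def)

lemma list_matrix_one:
  assumes f: "bij_betw f {0..<CARD('n)} UNIV"
  shows "list_matrix f (Finite_Cartesian_Product.mat 1 :: 'a::comm_ring_1 ^ 'n::finite ^ 'n) = 1\<^sub>m CARD('n)"
  using bij_betw_imp_inj_on[OF f]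
  by (intro eq_matI) (auto simp: list_matrix_def Finite_Cartesian_Product.mat_def inj_on_def)

lemma list_matrix_matpow:
  fixes B :: "'a::comm_ring_1 ^ 'n::finite ^ 'n"
  assumes f: "bij_betw f {0..<CARD('n)} UNIV"
  shows "list_matrix f (matpow B k) = list_matrix f B ^\<^sub>m k"
proof (induction k)
  case 0 then show ?case using list_matrix_one[OF f] by (simp add: list_matrix_def)
next
  case (Suc k)
  have "list_matrix f (matpow B (Suc k)) = list_matrix f (matpow B k ** B)"
    by (simp only: matpow_Suc_right)
  also have "\<dots> = list_matrix f B ^\<^sub>m Suc k"
    by (simp add: list_matrix_mult[OF f] Suc)
  finally show ?case .
qed

text \<open>Both determinants are sums over permutations; conjugation by the enumeration matches the two index
  sets and preserves signs.\<close>

lemma det_list_matrix: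
  fixes B :: "'a::comm_ring_1 ^ 'n::finite ^ 'n"
  assumes f: "bij_betw f {0..<CARD('n)} UNIV"
  shows "Determinant.det (list_matrix f B) = Determinants.det B"
proof -
  let ?N = "{0..<CARD('n)}"
  have inj: "inj_on f ?N" using f by (auto simp: bij_betw_def)
  have im: "f ` ?N = UNIV" using f by (auto simp: bij_betw_def)
  have bij: "bij_betw (map_permutation ?N f) {p. p permutes ?N} {p. p permutes UNIV}"
  proof (rule bij_betw_byWitness[where f' = "map_permutation UNIV (inv_into ?N f)"])
    have g: "bij_betw (inv_into ?N f) UNIV ?N" using f by (rule bij_betw_inv_into)
    show "\<forall>p\<in>{p. p permutes ?N}. map_permutation UNIV (inv_into ?N f) (map_permutation ?N f p) = p"
      using map_permutation_compose_inv[OF f] f by (auto simp: bij_betw_def)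
    show "\<forall>p\<in>{p. p permutes UNIV}. map_permutation ?N f (map_permutation UNIV (inv_into ?N f) p) = p"
    proof safe
      fix p :: "'n \<Rightarrow> 'n" assume p: "p permutes UNIV"
      show "map_permutation ?N f (map_permutation UNIV (inv_into ?N f) p) = p"
        by (rule map_permutation_compose_inv[OF g p]) (simp add: f_inv_into_f im)
    qed
    show "map_permutation ?N f ` {p. p permutes ?N} \<subseteq> {p. p permutes UNIV}"
      using map_permutation_permutes[OF f] by auto
    show "map_permutation UNIV (inv_into ?N f) ` {p. p permutes UNIV} \<subseteq> {p. p permutes ?N}"
      using map_permutation_permutes[OF g] by auto
  qed
  have "Determinants.det B = (\<Sum>p | p permutes ?N. of_int (sign (map_permutation ?N f p)) *
          (\<Prod>i\<in>UNIV. B $ i $ map_permutation ?N f p i))"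
    unfolding Determinants.det_def by (rule sum.reindex_bij_betw[OF bij, symmetric])
  also have "\<dots> = (\<Sum>p | p permutes ?N. of_int (sign p) * (\<Prod>i\<in>?N. list_matrix f B $$ (i, p i)))"
  proof (rule sum.cong[OF refl], safe)
    fix p assume p: "p permutes ?N"
    have "(\<Prod>i\<in>UNIV. B $ i $ map_permutation ?N f p i) = (\<Prod>i\<in>?N. B $ f i $ map_permutation ?N f p (f i))"
      by (rule prod.reindex_bij_betw[OF f, symmetric])
    also have "\<dots> = (\<Prod>i\<in>?N. list_matrix f B $$ (i, p i))"
      using permutes_in_image[OF p] by (intro prod.cong) (auto simp: list_matrix_def map_permutation_apply[OF inj])
    finally show "of_int (sign (map_permutation ?N f p)) * (\<Prod>i\<in>UNIV. B $ i $ map_permutation ?N f p i)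
       = of_int (sign p) * (\<Prod>i\<in>?N. list_matrix f B $$ (i, p i))"
      using sign_map_permutation[OF inj p] by simp
  qed
  also have "\<dots> = Determinant.det (list_matrix f B)"
    unfolding Determinant.det_def using list_matrix_def by (simp add: list_matrix_def)
  finally show ?thesis by simp
qed

lemma sum_diag_mult_commute:
  assumes "(X :: 'a::comm_ring_1 Matrix.mat) \<in> carrier_mat n n" "Y \<in> carrier_mat n n"
  shows "(\<Sum>i<n. (X * Y) $$ (i, i)) = (\<Sum>i<n. (Y * X) $$ (i, i))"
proof -
  have "(\<Sum>i<n. (X * Y) $$ (i, i)) = (\<Sum>i<n. \<Sum>j<n. X $$ (i, j) * Y $$ (j, i))"
    using assms by (intro sum.cong) (auto simp: scalar_prod_def atLeast0LessThan)
  also have "\<dots> = (\<Sum>j<n. \<Sum>i<n. Y $$ (j, i) * X $$ (i, j))"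
    by (subst sum.swap) (simp add: mult.commute)
  also have "\<dots> = (\<Sum>i<n. (Y * X) $$ (i, i))"
    using assms by (intro sum.cong) (auto simp: scalar_prod_def atLeast0LessThan)
  finally show ?thesis .
qed

lemma upper_triangular_power:
  assumes B: "(B :: 'a::comm_ring_1 Matrix.mat) \<in> carrier_mat n n" and ut: "upper_triangular B"
  shows "upper_triangular (B ^\<^sub>m k) \<and> (\<forall>i<n. (B ^\<^sub>m k) $$ (i, i) = B $$ (i, i) ^ k)"
proof (induction k)
  case 0 then show ?case using B by auto
next
  case (Suc k)
  let ?P = "B ^\<^sub>m k"
  have P: "?P \<in> carrier_mat n n" using B by simp
  have entry: "(?P * B) $$ (i, j) = (\<Sum>l<n. ?P $$ (i, l) * B $$ (l, j))" if "i < n" "j < n" for i j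
    using that P B by (auto simp: scalar_prod_def atLeast0LessThan intro!: sum.cong)
  have zP: "?P $$ (i, j) = 0" if "j < i" "i < n" for i j
    using Suc that P by (auto simp: upper_triangular_def)
  have zB: "B $$ (i, j) = 0" if "j < i" "i < n" for i j
    using ut that B by (auto simp: upper_triangular_def)
  have "(?P * B) $$ (i, j) = 0" if ji: "j < i" "i < n" for i j
  proof -
    have "?P $$ (i, l) * B $$ (l, j) = 0" if "l < n" for l
    proof (cases "l < i")
      case True then show ?thesis using zP ji by simp
    next
      case False then have "j < l" using ji by simp
      then show ?thesis using zB that by simp
    qed
    then show ?thesis using ji by (simp add: entry)
  qed
  moreover have "(?P * B) $$ (i, i) = B $$ (i, i) ^ Suc k" if i: "i < n" for i
  proof -
    have "(?P * B) $$ (i, i) = (\<Sum>l<n. if l = i then ?P $$ (i, i) * B $$ (i, i) else 0)"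
      unfolding entry[OF i i]
    proof (rule sum.cong[OF refl])
      fix l assume "l \<in> {..<n}"
      then show "?P $$ (i, l) * B $$ (l, i) = (if l = i then ?P $$ (i, i) * B $$ (i, i) else 0)"
        using zP[of l i] zB[of i l] i by (cases l i rule: linorder_cases) auto
    qed
    also have "\<dots> = ?P $$ (i, i) * B $$ (i, i)" using i by (simp add: sum.delta)
    finally show ?thesis using Suc i by (simp add: mult.commute)
  qed
  ultimately show ?case using P B by (auto simp: upper_triangular_def)
qed

lemma charpoly_list_matrix:
  fixes B :: "real ^ 'n::finite ^ 'n"
  assumes f: "bij_betw f {0..<CARD('n)} UNIV"
  shows "charpoly B = (- 1) ^ CARD('n) * char_poly (list_matrix f (map_matrix complex_of_real B))"
proof -
  let ?C = "list_matrix f (map_matrix complex_of_real B)"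
  have inj: "inj_on f {0..<CARD('n)}" using f by (auto simp: bij_betw_def)
  have "list_matrix f (map_matrix (\<lambda>b. [:complex_of_real b:]) B - Finite_Cartesian_Product.mat [:0, 1:])
      = (- 1) \<cdot>\<^sub>m char_poly_matrix ?C"
    using inj by (intro eq_matI)
     (auto simp: list_matrix_def char_poly_matrix_def Finite_Cartesian_Product.mat_def map_matrix_def inj_on_def)
  then have "charpoly B = Determinant.det ((- 1) \<cdot>\<^sub>m char_poly_matrix ?C)"
    unfolding charpoly_def det_list_matrix[OF f, symmetric] by (rule arg_cong)
  also have "\<dots> = (- 1) ^ CARD('n) * char_poly ?C"
    unfolding char_poly_def det_smult using char_poly_matrix_closed[OF list_matrix_carrier[of f "map_matrix complex_of_real B"]]
    by (auto simp only: carrier_matD)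
  finally show ?thesis .
qed

text \<open>By the Schur decomposition the matrix is similar to an upper triangular one with the eigenvalues on
  the diagonal. The diagonal of the \<open>k\<close>-th power of a triangular matrix consists of the \<open>k\<close>-th powers, and
  similar matrices have the same trace.\<close>

theorem charpoly_roots_and_power_traces:
  fixes B :: "real ^ 'n::finite ^ 'n"
  obtains E :: "complex multiset"
  where "size E = CARD('n)" "charpoly B = (\<Prod>e\<in>#E. [:e, -1:])"
    "\<And>k. complex_of_real (trace (matpow B k)) = (\<Sum>e\<in>#E. e ^ k)"
proof -
  obtain f :: "nat \<Rightarrow> 'n" where f: "bij_betw f {0..<CARD('n)} UNIV"
    using ex_bij_betw_nat_finite[of "UNIV :: 'n set"] by auto
  let ?n = "CARD('n)"
  define C where "C = list_matrix f (map_matrix complex_of_real B)"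
  have C: "C \<in> carrier_mat ?n ?n" by (simp add: C_def)
  obtain es where es: "char_poly C = (\<Prod>a\<leftarrow>es. [:- a, 1:])" "length es = ?n"
    using char_poly_factorized[OF C] by auto
  obtain D P Q where "schur_decomposition C es = (D, P, Q)" by (metis prod_cases3)
  note S = schur_decomposition[OF C es(1) this]
  have simD: "similar_mat_wit C D P Q" and utD: "upper_triangular D" and dgD: "diag_mat D = es"
    using S by auto
  have D: "D \<in> carrier_mat ?n ?n" and P: "P \<in> carrier_mat ?n ?n" and Q: "Q \<in> carrier_mat ?n ?n"
    using similar_mat_witD2(5-7)[OF C simD] .
  have "(\<Sum>i<?n. (C ^\<^sub>m k) $$ (i, i)) = (\<Sum>e\<in>#mset es. e ^ k)" for k
  proof -
    have sk: "similar_mat_wit (C ^\<^sub>m k) (D ^\<^sub>m k) P Q" by (rule similar_mat_wit_pow[OF simD])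
    have Ck: "C ^\<^sub>m k \<in> carrier_mat ?n ?n" and Dk: "D ^\<^sub>m k \<in> carrier_mat ?n ?n" using C D by auto
    have eq: "C ^\<^sub>m k = P * (D ^\<^sub>m k) * Q" and QP: "Q * P = 1\<^sub>m ?n"
      using similar_mat_witD2(2,3)[OF Ck sk] by simp_all
    have "(\<Sum>i<?n. (C ^\<^sub>m k) $$ (i, i)) = (\<Sum>i<?n. (Q * (P * (D ^\<^sub>m k))) $$ (i, i))"
      unfolding eq using P Q Dk by (intro sum_diag_mult_commute) auto
    also have "Q * (P * (D ^\<^sub>m k)) = D ^\<^sub>m k"
      using assoc_mult_mat[OF Q P Dk] left_mult_one_mat[OF Dk] QP by simp
    also have "(\<Sum>i<?n. (D ^\<^sub>m k) $$ (i, i)) = (\<Sum>i<?n. D $$ (i, i) ^ k)"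
      using upper_triangular_power[OF D utD] by simp
    also have "\<dots> = (\<Sum>i<?n. (es ! i) ^ k)"
      unfolding dgD[symmetric] using D by (intro sum.cong) (auto simp: diag_mat_def)
    also have "\<dots> = (\<Sum>e\<leftarrow>es. e ^ k)"
      by (simp add: sum_list_sum_nth es(2) atLeast0LessThan)
    also have "\<dots> = (\<Sum>e\<in>#mset es. e ^ k)" by (metis sum_mset_sum_list mset_map)
    finally show ?thesis .
  qed
  moreover have "complex_of_real (trace (matpow B k)) = (\<Sum>i<?n. (C ^\<^sub>m k) $$ (i, i))" for k
  proof -
    have hom: "map_matrix complex_of_real (matpow B k) = matpow (map_matrix complex_of_real B) k"
    proof (induction k)
      case 0 then show ?case by (simp add: map_matrix_def Finite_Cartesian_Product.mat_def vec_eq_iff)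
    next
      case (Suc k)
      have "map_matrix complex_of_real (B ** matpow B k) = map_matrix complex_of_real B ** map_matrix complex_of_real (matpow B k)"
        by (simp add: map_matrix_def matrix_matrix_mult_def vec_eq_iff)
      then show ?case using Suc by simp
    qed
    have "complex_of_real (trace (matpow B k)) = (\<Sum>i\<in>UNIV. map_matrix complex_of_real (matpow B k) $ i $ i)"
      by (simp add: trace_def map_matrix_def)
    also have "\<dots> = (\<Sum>i\<in>{0..<?n}. map_matrix complex_of_real (matpow B k) $ f i $ f i)"
      by (rule sum.reindex_bij_betw[OF f, symmetric])
    also have "\<dots> = (\<Sum>i<?n. (C ^\<^sub>m k) $$ (i, i))"
      unfolding C_def list_matrix_matpow[OF f, symmetric] hom
      by (intro sum.cong) (auto simp: list_matrix_def)
    finally show ?thesis .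
  qed
  moreover have "charpoly B = (\<Prod>e\<in>#mset es. [:e, -1:])"
  proof -
    have "(- 1 :: complex poly) ^ length xs * (\<Prod>a\<leftarrow>xs. [:- a, 1:]) = (\<Prod>e\<in>#mset xs. [:e, -1:])" for xs
    proof (induction xs)
      case (Cons a xs)
      have "(- 1 :: complex poly) ^ length (a # xs) * (\<Prod>a\<leftarrow>a # xs. [:- a, 1:])
          = (- [:- a, 1:]) * ((- 1) ^ length xs * (\<Prod>a\<leftarrow>xs. [:- a, 1:]))"
        by (simp only: length_Cons power_Suc list.map prod_list.Cons mult_minus_left mult_minus_right mult_1_left mult.left_commute)
      then show ?case by (simp only: Cons) simp
    qed simp
    from this[of es] show ?thesis using charpoly_list_matrix[OF f, of B] es by (simp add: C_def)
  qed
  ultimately show ?thesis using that[of "mset es"] es(2) by simp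
qed

hide_const (open) Matrix.mat Determinant.det

section \<open>Power sums of multisets of complex numbers\<close>

lemma sum_mset_poly:
  fixes E :: "complex multiset"
  shows "(\<Sum>e\<in>#E. poly q e) = (\<Sum>i\<le>degree q. coeff q i * (\<Sum>e\<in>#E. e ^ i))"
  by (induction E) (simp_all add: poly_altdef sum.distrib distrib_left)

lemma sum_mset_single_support:
  fixes E :: "complex multiset"
  assumes "\<And>e. e \<in># E \<Longrightarrow> e \<noteq> z \<Longrightarrow> f e = 0"
  shows "(\<Sum>e\<in>#E. f e) = of_nat (count E z) * (f z :: complex)"
  using assms by (induction E) (auto simp: algebra_simps)

text \<open>Such a polynomial, summed over a multiset supported in \<open>S\<close>, extracts the multiplicity of \<open>z\<close>. As the
  sum is a combination of power sums, these determine the multiplicities.\<close>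

lemma isolating_poly:
  fixes S :: "complex set"
  assumes "finite S"
  obtains q where "poly q z \<noteq> 0" "\<And>w. w \<in> S \<Longrightarrow> w \<noteq> z \<Longrightarrow> poly q w = 0"
proof
  let ?q = "\<Prod>w\<in>S - {z}. [:- w, 1:]"
  show "poly ?q z \<noteq> 0" using assms by (simp add: poly_prod)
  show "poly ?q w = 0" if "w \<in> S" "w \<noteq> z" for w using assms that by (auto simp: poly_prod)
qed

lemma mset_eq_of_power_sums:
  fixes E F :: "complex multiset"
  assumes "\<And>k. (\<Sum>e\<in>#E. e ^ k) = (\<Sum>e\<in>#F. e ^ k)"
  shows "E = F"
proof (rule multiset_eqI)
  fix z
  obtain q where q: "poly q z \<noteq> 0" "\<And>w. w \<in> set_mset E \<union> set_mset F \<Longrightarrow> w \<noteq> z \<Longrightarrow> poly q w = 0"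
    using isolating_poly[of "set_mset E \<union> set_mset F" z] by auto
  have "(\<Sum>e\<in>#E. poly q e) = (\<Sum>e\<in>#F. poly q e)" by (simp add: sum_mset_poly assms)
  then have "of_nat (count E z) * poly q z = of_nat (count F z) * poly q z"
    using sum_mset_single_support[of E z "poly q"] sum_mset_single_support[of F z "poly q"] q(2) by simp
  then show "count E z = count F z" using q(1) by simp
qed

text \<open>An isolating polynomial multiplied by the variable has no constant term, so only power sums with
  positive exponent enter.\<close>

lemma power_sum_nonzero:
  fixes E :: "complex multiset"
  assumes "z \<in># E" "z \<noteq> 0"
  obtains k where "k > 0" "(\<Sum>e\<in>#E. e ^ k) \<noteq> 0"
proof -
  obtain q where q: "poly q z \<noteq> 0" "\<And>w. w \<in> set_mset E \<Longrightarrow> w \<noteq> z \<Longrightarrow> poly q w = 0"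
    using isolating_poly[of "set_mset E" z] by auto
  let ?r = "[:0, 1:] * q"
  have "(\<Sum>e\<in>#E. poly ?r e) = of_nat (count E z) * poly ?r z"
    by (rule sum_mset_single_support) (use q in auto)
  also have "\<dots> \<noteq> 0" using assms q(1) by simp
  finally have "(\<Sum>i\<le>degree ?r. coeff ?r i * (\<Sum>e\<in>#E. e ^ i)) \<noteq> 0"
    unfolding sum_mset_poly .
  then obtain i where i: "coeff ?r i * (\<Sum>e\<in>#E. e ^ i) \<noteq> 0" by (meson sum.neutral)
  have "coeff ?r 0 = 0" by simp
  then have "i > 0" using i by (metis gr0I mult_zero_left)
  moreover have "(\<Sum>e\<in>#E. e ^ i) \<noteq> 0" using i by (metis mult_zero_right)
  ultimately show ?thesis by (rule that)
qed

lemma finite_multisets_of_size: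
  assumes "finite S" shows "finite (multisets_of_size S n)"
proof -
  obtain xs where "set xs = S" "distinct xs" using finite_distinct_list[OF assms] by blast
  then show ?thesis using multisets_of_size_list_correct[of xs n] by (metis finite_imageI finite_set)
qed

section \<open>Eigenvalues of real matrices\<close>

definition eigenvalues :: "real ^ 'n::finite ^ 'n \<Rightarrow> complex multiset" where
  "eigenvalues B = proots (charpoly B)"

lemma
  fixes B :: "real ^ 'n::finite ^ 'n"
  shows size_eigenvalues: "size (eigenvalues B) = CARD('n)"
    and charpoly_eigenvalues: "charpoly B = (\<Prod>e\<in>#eigenvalues B. [:e, -1:])"
    and trace_eigenvalues: "complex_of_real (trace (matpow B k)) = (\<Sum>e\<in>#eigenvalues B. e ^ k)"
    and set_eigenvalues: "set_mset (eigenvalues B) = {z. poly (charpoly B) z = 0}"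
proof -
  obtain E where E: "size E = CARD('n)" "charpoly B = (\<Prod>e\<in>#E. [:e, -1:])"
    "\<And>k. complex_of_real (trace (matpow B k)) = (\<Sum>e\<in>#E. e ^ k)"
    using charpoly_roots_and_power_traces[of B] by blast
  have nz: "(\<Prod>e\<in>#F. [:e, -1:]) \<noteq> (0 :: complex poly)" for F by auto
  have lin: "proots [:e, -1:] = {#e :: complex#}" for e
    using proots_uminus[of "[:- e, 1:]"] proots_linear_factor[of "- e"] by simp
  have roots: "proots (\<Prod>e\<in>#F. [:e, -1:]) = (F :: complex multiset)" for F
  proof (induction F)
    case (add e F)
    then show ?case using proots_mult[of "[:e, -1:]" "\<Prod>e\<in>#F. [:e, -1:]"] nz[of F] lin[of e] by simp
  qed simp
  have EB: "eigenvalues B = E" by (simp add: eigenvalues_def E(2) roots)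
  show "size (eigenvalues B) = CARD('n)" "charpoly B = (\<Prod>e\<in>#eigenvalues B. [:e, -1:])"
    "complex_of_real (trace (matpow B k)) = (\<Sum>e\<in>#eigenvalues B. e ^ k)"
    using E by (simp_all add: EB)
  have "charpoly B \<noteq> 0" using E(2) nz by simp
  then show "set_mset (eigenvalues B) = {z. poly (charpoly B) z = 0}"
    by (simp add: eigenvalues_def set_count_proots)
qed

lemma poly_charpoly:
  "poly (charpoly B) z = det (map_matrix complex_of_real B - mat z)"
  unfolding charpoly_def Determinants.det_def
  by (simp add: poly_sum poly_prod map_matrix_def Finite_Cartesian_Product.mat_def of_int_poly) (auto intro!: sum.cong prod.cong)

text \<open>The value of the characteristic polynomial at \<open>z\<close> is the product of the differences between the
  eigenvalues and \<open>z\<close>, and the closest eigenvalue has the smallest factor. Hence, if \<open>z\<close> is nearly a root,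
  an eigenvalue is near \<open>z\<close>.\<close>

lemma eigenvalue_near:
  fixes B :: "real ^ 'n::finite ^ 'n"
  obtains e where "e \<in># eigenvalues B" "norm (e - z) ^ CARD('n) \<le> norm (poly (charpoly B) z)"
proof -
  let ?E = "eigenvalues B"
  have ne: "set_mset ?E \<noteq> {}" using size_eigenvalues[of B] by (metis nonempty_has_size set_mset_eq_empty_iff zero_less_card_finite)
  define m where "m = Min ((\<lambda>e. norm (e - z)) ` set_mset ?E)"
  have "m \<in> (\<lambda>e. norm (e - z)) ` set_mset ?E" unfolding m_def using ne by (intro Min_in) auto
  then obtain e where e: "e \<in># ?E" "norm (e - z) = m" by blast
  have min: "m \<le> norm (w - z)" if "w \<in># ?E" for w unfolding m_def using that by auto
  have "m ^ size F \<le> norm (poly (\<Prod>e\<in>#F. [:e, -1:]) z)" if "F \<subseteq># ?E" for F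
    using that
  proof (induction F)
    case (add w F)
    then have "w \<in># ?E" "F \<subseteq># ?E"
      using mset_subset_eq_insertD[OF add.prems] by (auto simp: subset_mset.less_imp_le)
    then have "m * m ^ size F \<le> norm (w - z) * norm (poly (\<Prod>e\<in>#F. [:e, -1:]) z)"
      using min add.IH e(2) by (intro mult_mono) auto
    then show ?case by (simp add: norm_mult[symmetric] algebra_simps)
  qed simp
  from this[of ?E] have "m ^ CARD('n) \<le> norm (poly (charpoly B) z)"
    using charpoly_eigenvalues[of B] by (simp add: size_eigenvalues)
  then show ?thesis using that e by metis
qed

definition spectral_radius :: "complex multiset \<Rightarrow> real" where
  "spectral_radius E = Max (norm ` set_mset E)"

lemma spectral_radius_pos:
  assumes "z \<in># E" "z \<noteq> 0"
  shows "spectral_radius E > 0"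
proof -
  have "norm z \<le> spectral_radius E" unfolding spectral_radius_def using assms by (intro Max_ge) auto
  then show ?thesis using assms(2) by (meson less_le_trans zero_less_norm_iff)
qed

lemma spectral_radius_scale:
  assumes "set_mset E = (\<lambda>z. complex_of_real t * z) ` set_mset F" "F \<noteq> {#}"
  shows "spectral_radius E = \<bar>t\<bar> * spectral_radius F"
proof -
  have "norm ` set_mset E = (\<lambda>r. \<bar>t\<bar> * r) ` norm ` set_mset F"
    by (simp add: assms(1) image_image norm_mult)
  moreover have "Max ((\<lambda>r. \<bar>t\<bar> * r) ` norm ` set_mset F) = \<bar>t\<bar> * Max (norm ` set_mset F)"
    using assms(2) by (intro mono_Max_commute[symmetric]) (auto simp: mono_def mult_left_mono)
  ultimately show ?thesis by (simp add: spectral_radius_def)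
qed

text \<open>Nearby multisets contain points near every point of \<open>E0\<close>, but they might contain further points far
  away, so in general only the lower bound for the radius follows. Here all nonzero points are those of \<open>E0\<close>
  times one factor \<open>t\<close>. A point near an element of \<open>E0\<close> of smallest nonzero modulus \<open>\<mu>\<close> is itself nonzero,
  so its modulus is at least \<open>\<bar>t\<bar> \<mu>\<close>; this bounds \<open>\<bar>t\<bar>\<close>, and thereby the radius, from above.\<close>

lemma spectral_radius_tendsto:
  fixes E :: "'x \<Rightarrow> complex multiset"
  assumes near: "\<And>z \<delta>. z \<in># E0 \<Longrightarrow> \<delta> > 0 \<Longrightarrow> \<forall>\<^sub>F x in F. \<exists>e. e \<in># E x \<and> norm (e - z) < \<delta>"
    and scaled: "\<forall>\<^sub>F x in F. \<exists>t. set_mset (E x) = (\<lambda>z. complex_of_real t * z) ` set_mset E0"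
    and nz: "z0 \<in># E0" "z0 \<noteq> 0"
  shows "((\<lambda>x. spectral_radius (E x)) \<longlongrightarrow> spectral_radius E0) F"
proof (rule tendstoI)
  fix \<epsilon> :: real assume \<epsilon>: "\<epsilon> > 0"
  let ?\<rho> = "spectral_radius E0"
  have \<rho>: "?\<rho> > 0" using spectral_radius_pos[OF nz] .
  have ne: "E0 \<noteq> {#}" using nz by auto
  have "?\<rho> \<in> norm ` set_mset E0" unfolding spectral_radius_def using nz by (intro Max_in) auto
  then obtain zM where zM: "zM \<in># E0" "norm zM = ?\<rho>" by auto
  define N where "N = norm ` (set_mset E0 - {0})"
  have N: "finite N" "N \<noteq> {}" using nz by (auto simp: N_def)
  define \<mu> where "\<mu> = Min N"
  have "\<mu> \<in> N" unfolding \<mu>_def using N by simp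
  then obtain zm where zm: "zm \<in># E0" "norm zm = \<mu>" "zm \<noteq> 0" by (auto simp: N_def)
  then have \<mu>_pos: "\<mu> > 0" by auto
  have \<mu>: "\<mu> \<le> norm w" if "w \<in># E0" "w \<noteq> 0" for w
    unfolding \<mu>_def using N that by (intro Min_le) (auto simp: N_def)
  \<comment> \<open>below \<open>\<mu>\<close>, so that points within \<open>\<eta>\<close> of \<open>zm\<close> are nonzero; the other bound turns \<open>\<bar>t\<bar> \<mu> < \<mu> + \<eta>\<close> into \<open>\<bar>t\<bar> ?\<rho> < ?\<rho> + \<epsilon>\<close>\<close>
  define \<eta> where "\<eta> = min \<mu> (\<epsilon> * \<mu> / ?\<rho>)"
  have \<eta>: "\<eta> > 0" "\<eta> \<le> \<mu>" "\<eta> * ?\<rho> \<le> \<epsilon> * \<mu>"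
    using \<epsilon> \<rho> \<mu>_pos by (auto simp: \<eta>_def min_def field_simps)
  show "\<forall>\<^sub>F x in F. dist (spectral_radius (E x)) ?\<rho> < \<epsilon>"
    using near[OF zM(1) \<epsilon>] near[OF zm(1) \<eta>(1)] scaled
  proof eventually_elim
    case (elim x)
    obtain t where t: "set_mset (E x) = (\<lambda>z. complex_of_real t * z) ` set_mset E0" using elim(3) by blast
    have sr: "spectral_radius (E x) = \<bar>t\<bar> * ?\<rho>" by (rule spectral_radius_scale[OF t ne])
    obtain e where e: "e \<in># E x" "norm (e - zM) < \<epsilon>" using elim(1) by blast
    have "norm e \<le> spectral_radius (E x)" unfolding spectral_radius_def using e by (intro Max_ge) auto
    then have low: "?\<rho> - \<epsilon> < spectral_radius (E x)"
      using e(2) zM(2) norm_triangle_ineq2[of zM e] by (simp add: norm_minus_commute)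
    obtain e' where e': "e' \<in># E x" "norm (e' - zm) < \<eta>" using elim(2) by blast
    then obtain w where w: "w \<in># E0" "e' = complex_of_real t * w" using t by auto
    have "e' \<noteq> 0" using e'(2) \<eta>(2) zm(2) by auto
    then have "w \<noteq> 0" using w by auto
    then have "\<bar>t\<bar> * \<mu> \<le> norm e'" using \<mu>[OF w(1)] w(2) by (simp add: norm_mult mult_left_mono)
    also have "\<dots> < \<mu> + \<eta>" using e'(2) zm(2) norm_triangle_ineq2[of e' zm] by simp
    finally have "\<bar>t\<bar> * \<mu> * ?\<rho> < (\<mu> + \<eta>) * ?\<rho>" using \<rho> by simp
    also have "\<dots> \<le> (?\<rho> + \<epsilon>) * \<mu>" using \<eta>(3) by (simp add: algebra_simps)
    finally have "spectral_radius (E x) < ?\<rho> + \<epsilon>" using \<mu>_pos by (simp add: sr mult_ac)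
    then show ?case using low by (simp add: dist_real_def abs_if)
  qed
qed

section \<open>Charts, tangent vectors and vector fields\<close>

locale atlas =
  fixes A :: "('m::{t2_space, second_countable_topology}, 'n::finite) chart set"
  assumes manifold: "smooth_manifold A"
begin

abbreviation overlap :: "('m, 'n) chart \<Rightarrow> ('m, 'n) chart \<Rightarrow> (real ^ 'n) set" where
  "overlap c d \<equiv> chart_map c ` (chart_dom c \<inter> chart_dom d)"

abbreviation jac :: "('m, 'n) chart \<Rightarrow> ('m, 'n) chart \<Rightarrow> 'm \<Rightarrow> real ^ 'n \<Rightarrow> real ^ 'n" where
  "jac c d p \<equiv> frechet_derivative (transition c d) (at (chart_map c p))"

lemma chart_homeomorphism:
  assumes "c \<in> A"
  shows "homeomorphism (chart_dom c) (chart_image c) (chart_map c) (chart_inv c)"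
proof -
  obtain g where g: "homeomorphism (chart_dom c) (chart_image c) (chart_map c) g"
    using assms manifold unfolding smooth_manifold_def is_chart_def by blast
  have "g u = chart_inv c u" if "u \<in> chart_image c" for u
    using g that unfolding homeomorphism_def
    by (metis (no_types, lifting) inv_into_f_f inj_on_inverseI image_eqI)
  then show ?thesis
    by (intro homeomorphism_cong[OF g]) auto
qed

lemma open_chart_dom: "c \<in> A \<Longrightarrow> open (chart_dom c)"
  and open_chart_image: "c \<in> A \<Longrightarrow> open (chart_image c)"
  using manifold unfolding smooth_manifold_def is_chart_def by blast+

lemma chart_inv_chart_map [simp]: "c \<in> A \<Longrightarrow> p \<in> chart_dom c \<Longrightarrow> chart_inv c (chart_map c p) = p"
  using chart_homeomorphism homeomorphism_apply1 by blast

lemma chart_map_chart_inv [simp]: "u \<in> chart_image c \<Longrightarrow> chart_map c (chart_inv c u) = u"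
  by (rule f_inv_into_f)

lemma chart_inv_in_dom [simp]: "u \<in> chart_image c \<Longrightarrow> chart_inv c u \<in> chart_dom c"
  by (rule inv_into_into)

lemma continuous_on_chart_inv: "c \<in> A \<Longrightarrow> continuous_on (chart_image c) (chart_inv c)"
  using chart_homeomorphism homeomorphism_def by blast

lemma open_chart_vimage:
  assumes "c \<in> A" "open W"
  shows "open (chart_image c \<inter> chart_inv c -` W)"
  using continuous_on_chart_inv[OF assms(1)] continuous_on_open_vimage[OF open_chart_image[OF assms(1)]] assms(2)
  by (metis inf_commute)

lemma overlap_eq: "c \<in> A \<Longrightarrow> overlap c d = chart_image c \<inter> chart_inv c -` chart_dom d"
  by (force simp: image_iff)

lemma open_overlap: "c \<in> A \<Longrightarrow> d \<in> A \<Longrightarrow> open (overlap c d)"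
  using open_chart_vimage[OF _ open_chart_dom] overlap_eq by metis

lemma transition_smooth: "c \<in> A \<Longrightarrow> d \<in> A \<Longrightarrow> smooth_on (overlap c d) (transition c d)"
  using manifold unfolding smooth_manifold_def by blast

lemma transition_chart_map: "c \<in> A \<Longrightarrow> p \<in> chart_dom c \<Longrightarrow> transition c d (chart_map c p) = chart_map d p"
  by (simp add: transition_def)

lemma jac_has_derivative:
  assumes "c \<in> A" "d \<in> A" "p \<in> chart_dom c" "p \<in> chart_dom d"
  shows "(transition c d has_derivative jac c d p) (at (chart_map c p))"
  using assms by (intro smooth_on_has_derivative[OF transition_smooth]) auto

lemma jac_linear:
  assumes "c \<in> A" "d \<in> A" "p \<in> chart_dom c" "p \<in> chart_dom d"
  shows "linear (jac c d p)"
  using jac_has_derivative[OF assms] has_derivative_linear by blast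

text \<open>The cocycle rule for the Jacobians, by the chain rule on the triple overlap. It makes the families
  \<open>tangent_of\<close> compatible with all charts.\<close>

lemma jac_compose:
  assumes "c \<in> A" "d \<in> A" "e \<in> A" "p \<in> chart_dom c" "p \<in> chart_dom d" "p \<in> chart_dom e"
  shows "jac d e p (jac c d p v) = jac c e p v"
proof -
  let ?U = "chart_map c ` (chart_dom c \<inter> (chart_dom d \<inter> chart_dom e))"
  have "?U = chart_image c \<inter> chart_inv c -` (chart_dom d \<inter> chart_dom e)"
    using assms by (force simp: image_iff)
  then have U: "open ?U" using open_chart_vimage assms open_chart_dom by (metis open_Int)
  have "(transition d e has_derivative jac d e p) (at (transition c d (chart_map c p)))"
    using jac_has_derivative[of d e p] assms by (simp add: transition_chart_map)
  then have "(transition d e \<circ> transition c d has_derivative jac d e p \<circ> jac c d p) (at (chart_map c p))"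
    by (rule diff_chain_at[OF jac_has_derivative[OF assms(1,2,4,5)]])
  then have "(transition c e has_derivative jac d e p \<circ> jac c d p) (at (chart_map c p))"
    by (rule has_derivative_transform_within_open[OF _ U]) (use assms in \<open>auto simp: transition_def\<close>)
  then have "jac d e p \<circ> jac c d p = jac c e p"
    by (rule frechet_derivative_at)
  then show ?thesis by (metis comp_apply)
qed

lemma jac_self:
  assumes "c \<in> A" "p \<in> chart_dom c"
  shows "jac c c p v = v"
proof -
  have "(transition c c has_derivative (\<lambda>v. v)) (at (chart_map c p))"
    by (rule has_derivative_transform_within_open[OF _ open_chart_image[OF assms(1)]])
       (use assms in \<open>auto simp: transition_def has_derivative_ident\<close>)
  from frechet_derivative_at[OF this] show ?thesis by metis
qed

lemma tangent_of_apply [simp]: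
  "c \<in> A \<Longrightarrow> p \<in> chart_dom c \<Longrightarrow> tangent_of A c p u c = u"
  by (simp add: tangent_of_def jac_self)

lemma tangent_of_in_tangent_space:
  assumes "c \<in> A" "p \<in> chart_dom c"
  shows "tangent_of A c p u \<in> tangent_space A p"
  using assms by (auto simp: tangent_space_def tangent_of_def jac_compose)

lemma tangent_space_change_chart:
  assumes "v \<in> tangent_space A p" "c \<in> A" "d \<in> A" "p \<in> chart_dom c" "p \<in> chart_dom d"
  shows "v d = jac c d p (v c)"
  using assms unfolding tangent_space_def by blast

lemma tangent_space_outside: "v \<in> tangent_space A p \<Longrightarrow> \<not> (c \<in> A \<and> p \<in> chart_dom c) \<Longrightarrow> v c = 0"
  unfolding tangent_space_def by blast

lemma tangent_spaceI:
  assumes "\<And>c. \<not> (c \<in> A \<and> p \<in> chart_dom c) \<Longrightarrow> v c = 0"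
    "\<And>c d. c \<in> A \<Longrightarrow> d \<in> A \<Longrightarrow> p \<in> chart_dom c \<Longrightarrow> p \<in> chart_dom d \<Longrightarrow> v d = jac c d p (v c)"
  shows "v \<in> tangent_space A p"
  using assms unfolding tangent_space_def by blast

lemma tangent_of_component:
  assumes "c \<in> A" "p \<in> chart_dom c" "v \<in> tangent_space A p"
  shows "tangent_of A c p (v c) = v"
proof
  fix d
  show "tangent_of A c p (v c) d = v d"
  proof (cases "d \<in> A \<and> p \<in> chart_dom d")
    case True
    then show ?thesis using tangent_space_change_chart[OF assms(3,1) _ assms(2), of d] by (simp add: tangent_of_def)
  next
    case False
    then show ?thesis using tangent_space_outside[OF assms(3), of d] by (auto simp add: tangent_of_def)
  qed
qed

lemma tangent_space_eqI:
  assumes "v \<in> tangent_space A p" "w \<in> tangent_space A p" "c \<in> A" "p \<in> chart_dom c" "v c = w c"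
  shows "v = w"
  using tangent_of_component assms by metis

lemma tangent_space_zero: "(\<lambda>c. 0) \<in> tangent_space A p"
  by (rule tangent_spaceI) (simp_all add: linear_0[OF jac_linear])

lemma tangent_space_add:
  assumes "v \<in> tangent_space A p" "w \<in> tangent_space A p"
  shows "(\<lambda>c. v c + w c) \<in> tangent_space A p"
proof (rule tangent_spaceI)
  fix c d assume cd: "c \<in> A" "d \<in> A" "p \<in> chart_dom c" "p \<in> chart_dom d"
  show "v d + w d = jac c d p (v c + w c)"
    unfolding linear_add[OF jac_linear[OF cd]] using tangent_space_change_chart[OF _ cd] assms by metis
qed (simp add: tangent_space_outside[OF assms(1)] tangent_space_outside[OF assms(2)])

lemma tangent_space_scale:
  assumes "v \<in> tangent_space A p"
  shows "(\<lambda>c. a *\<^sub>R v c) \<in> tangent_space A p"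
proof (rule tangent_spaceI)
  fix c d assume cd: "c \<in> A" "d \<in> A" "p \<in> chart_dom c" "p \<in> chart_dom d"
  show "a *\<^sub>R v d = jac c d p (a *\<^sub>R v c)"
    unfolding linear_scale[OF jac_linear[OF cd]] using tangent_space_change_chart[OF assms cd] by metis
qed (simp add: tangent_space_outside[OF assms])

lemma vfields_tangent: "X \<in> vfields A \<Longrightarrow> X p \<in> tangent_space A p"
  by (simp add: vfields_def)

lemma vfields_smooth: "X \<in> vfields A \<Longrightarrow> c \<in> A \<Longrightarrow> smooth_on (chart_image c) (vf_rep c X)"
  by (simp add: vfields_def)

lemma vf_add_vfields: "X \<in> vfields A \<Longrightarrow> Y \<in> vfields A \<Longrightarrow> vf_add X Y \<in> vfields A"
  unfolding vfields_def vf_add_def vf_rep_def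
  by (auto intro: tangent_space_add smooth_on_add open_chart_image)

lemma vf_scale_vfields: "smooth_fun A f \<Longrightarrow> X \<in> vfields A \<Longrightarrow> vf_scale f X \<in> vfields A"
  unfolding vfields_def vf_scale_def vf_rep_def smooth_fun_def o_def
  by (auto intro: tangent_space_scale smooth_on_scaleR open_chart_image)

lemma smooth_fun_const: "smooth_fun A (\<lambda>p. a)"
  by (auto simp: smooth_fun_def o_def intro: smooth_on_const open_chart_image)

lemma smooth_fun_mult: "smooth_fun A f \<Longrightarrow> smooth_fun A g \<Longrightarrow> smooth_fun A (\<lambda>p. f p * g p)"
  unfolding smooth_fun_def o_def by (auto intro: smooth_on_mult open_chart_image)

lemma smooth_fun_add: "smooth_fun A f \<Longrightarrow> smooth_fun A g \<Longrightarrow> smooth_fun A (\<lambda>p. f p + g p)"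
  unfolding smooth_fun_def o_def by (auto intro: smooth_on_add open_chart_image)

lemma vf_diff_eq: "vf_diff X Y = vf_add X (vf_scale (\<lambda>p. - 1) Y)"
  by (simp add: vf_diff_def vf_add_def vf_scale_def)

lemma vf_diff_vfields: "X \<in> vfields A \<Longrightarrow> Y \<in> vfields A \<Longrightarrow> vf_diff X Y \<in> vfields A"
  by (simp add: vf_diff_eq vf_add_vfields vf_scale_vfields smooth_fun_const)

definition vf_lincomb :: "'i set \<Rightarrow> ('i \<Rightarrow> 'm \<Rightarrow> real) \<Rightarrow> ('i \<Rightarrow> ('m, 'n) vfield) \<Rightarrow> ('m, 'n) vfield" where
  "vf_lincomb I f F = (\<lambda>p c. \<Sum>i\<in>I. f i p *\<^sub>R F i p c)"

lemma vf_lincomb_empty: "vf_lincomb {} f F = vf_scale (\<lambda>p. 0) X"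
  by (simp add: vf_lincomb_def vf_scale_def)

lemma vf_lincomb_insert:
  "finite I \<Longrightarrow> i \<notin> I \<Longrightarrow> vf_lincomb (insert i I) f F = vf_add (vf_scale (f i) (F i)) (vf_lincomb I f F)"
  by (simp add: vf_lincomb_def vf_add_def vf_scale_def)

lemma vf_lincomb_vfields:
  assumes "finite I" "I \<noteq> {}" "\<And>i. i \<in> I \<Longrightarrow> smooth_fun A (f i)" "\<And>i. i \<in> I \<Longrightarrow> F i \<in> vfields A"
  shows "vf_lincomb I f F \<in> vfields A"
proof -
  obtain X where X: "X \<in> vfields A" using assms by blast
  show ?thesis
    using assms(1,3,4)
  proof (induction I rule: finite_induct)
    case empty
    then show ?case using vf_lincomb_empty[of f F X] by (simp add: vf_scale_vfields X smooth_fun_const)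
  qed (simp add: vf_lincomb_insert vf_add_vfields vf_scale_vfields)
qed

text \<open>A function supported in a compact part of the domain of \<open>c\<close> can only fail to be smooth there: the
  support is closed, the space being Hausdorff, so near every other point the function vanishes.\<close>

lemma smooth_on_supported:
  fixes F :: "'m \<Rightarrow> 'b::euclidean_space"
  assumes "c \<in> A" "d \<in> A" "compact K" "K \<subseteq> chart_dom c" "\<And>q. q \<notin> K \<Longrightarrow> F q = 0"
    and smooth: "smooth_on (overlap d c) (\<lambda>u. F (chart_inv d u))"
  shows "smooth_on (chart_image d) (\<lambda>u. F (chart_inv d u))"
proof (rule smooth_on_local)
  fix u assume u: "u \<in> chart_image d"
  show "\<exists>U. open U \<and> u \<in> U \<and> smooth_on U (\<lambda>u. F (chart_inv d u))"
  proof (cases "chart_inv d u \<in> chart_dom c")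
    case True
    then have "u \<in> overlap d c" using u overlap_eq[OF assms(2)] by blast
    then show ?thesis using smooth open_overlap[OF assms(2,1)] by blast
  next
    case False
    let ?U = "chart_image d \<inter> chart_inv d -` (- K)"
    have U: "open ?U" using assms by (intro open_chart_vimage) (auto intro: compact_imp_closed)
    have "smooth_on ?U (\<lambda>u. F (chart_inv d u))"
      by (rule smooth_on_cong[OF U _ smooth_on_const[OF U, of 0]]) (use assms(5) in auto)
    then show ?thesis using U u False assms(4) by blast
  qed
qed

lemma compact_chart_ball:
  assumes "c \<in> A" "cball a r \<subseteq> chart_image c"
  shows "compact (chart_inv c ` cball a r)" "chart_inv c ` cball a r \<subseteq> chart_dom c"
  using assms continuous_on_subset[OF continuous_on_chart_inv] chart_inv_in_dom
  by (auto intro!: compact_continuous_image)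

lemma transition_compose_smooth:
  assumes "c \<in> A" "d \<in> A" "smooth_on (chart_image c) f"
  shows "smooth_on (overlap d c) (\<lambda>u. f (transition d c u))"
  by (rule smooth_on_compose[OF open_overlap open_chart_image transition_smooth assms(3)])
     (use assms in \<open>auto simp: transition_chart_map\<close>)

lemma smooth_fun_extend:
  assumes "c \<in> A" "cball a r \<subseteq> chart_image c" "smooth_on (chart_image c) f"
    "\<And>u. u \<notin> cball a r \<Longrightarrow> f u = 0"
  shows "smooth_fun A (\<lambda>q. if q \<in> chart_dom c then f (chart_map c q) else 0)"
  unfolding smooth_fun_def o_def
proof
  fix d assume d: "d \<in> A"
  show "smooth_on (chart_image d) (\<lambda>u. if chart_inv d u \<in> chart_dom c then f (chart_map c (chart_inv d u)) else 0)"
  proof (rule smooth_on_supported[OF assms(1) d compact_chart_ball[OF assms(1,2)],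
        where F = "\<lambda>q. if q \<in> chart_dom c then f (chart_map c q) else 0"])
    fix q assume q: "q \<notin> chart_inv c ` cball a r"
    show "(if q \<in> chart_dom c then f (chart_map c q) else 0) = 0"
    proof (cases "q \<in> chart_dom c")
      case True
      then have "chart_map c q \<notin> cball a r" using q assms(1) by (metis chart_inv_chart_map image_eqI)
      then show ?thesis using assms(4) by simp
    qed simp
  next
    show "smooth_on (overlap d c) (\<lambda>u. if chart_inv d u \<in> chart_dom c then f (chart_map c (chart_inv d u)) else 0)"
      by (rule smooth_on_cong[OF open_overlap[OF d assms(1)] _ transition_compose_smooth[OF assms(1) d assms(3)]])
         (use d in \<open>auto simp: transition_def\<close>)
  qed
qed

text \<open>The vector field with components \<open>W\<close> in the chart \<open>c\<close>, extended by \<open>0\<close>. It is smooth when \<open>W\<close> has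
  compact support in the image of \<open>c\<close>.\<close>

definition vf_of :: "('m, 'n) chart \<Rightarrow> (real ^ 'n \<Rightarrow> real ^ 'n) \<Rightarrow> ('m, 'n) vfield" where
  "vf_of c W = (\<lambda>q. if q \<in> chart_dom c then tangent_of A c q (W (chart_map c q)) else (\<lambda>d. 0))"

lemma vf_of_vfields:
  assumes "c \<in> A" "cball a r \<subseteq> chart_image c" "smooth_on (chart_image c) W"
    "\<And>u. u \<notin> cball a r \<Longrightarrow> W u = 0"
  shows "vf_of c W \<in> vfields A"
  unfolding vfields_def
proof (intro CollectI conjI allI ballI)
  show "vf_of c W p \<in> tangent_space A p" for p
    using assms(1) by (simp add: vf_of_def tangent_of_in_tangent_space tangent_space_zero)
next
  fix d assume d: "d \<in> A"
  have "smooth_on (chart_image d) (\<lambda>u. vf_of c W (chart_inv d u) d)"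
  proof (rule smooth_on_supported[OF assms(1) d compact_chart_ball[OF assms(1,2)], where F = "\<lambda>q. vf_of c W q d"])
    fix q assume q: "q \<notin> chart_inv c ` cball a r"
    show "vf_of c W q d = 0"
    proof (cases "q \<in> chart_dom c")
      case True
      then have "chart_map c q \<notin> cball a r" using q assms(1) by (metis chart_inv_chart_map image_eqI)
      then show ?thesis using True d assms(1,4)
        by (simp add: vf_of_def tangent_of_def linear_0[OF jac_linear])
    qed (simp add: vf_of_def)
  next
    let ?t = "transition d c"
    have *: "smooth_on (overlap d c) (\<lambda>u. \<Sum>b\<in>Basis. (W (?t u) \<bullet> b) *\<^sub>R frechet_derivative (transition c d) (at (?t u)) b)"
    proof (intro smooth_on_sum smooth_on_scaleR smooth_on_inner smooth_on_const open_overlap d assms(1))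
      show "smooth_on (overlap d c) (\<lambda>u. W (?t u))"
        by (rule transition_compose_smooth[OF assms(1) d assms(3)])
    next
      fix b
      show "smooth_on (overlap d c) (\<lambda>u. frechet_derivative (transition c d) (at (?t u)) b)"
        by (rule smooth_on_compose[OF open_overlap[OF d assms(1)] open_overlap[OF assms(1) d] transition_smooth[OF d assms(1)],
             where g = "\<lambda>y. frechet_derivative (transition c d) (at y) b"])
           (use d assms in \<open>auto simp: transition_chart_map intro!: smooth_on_frechet_derivative transition_smooth\<close>)
    qed
    show "smooth_on (overlap d c) (\<lambda>u. vf_of c W (chart_inv d u) d)"
    proof (rule smooth_on_cong[OF open_overlap[OF d assms(1)] _ *])
      fix u assume "u \<in> overlap d c"
      then obtain q where q: "u = chart_map d q" "q \<in> chart_dom d" "q \<in> chart_dom c" by blast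
      show "(\<Sum>b\<in>Basis. (W (?t u) \<bullet> b) *\<^sub>R frechet_derivative (transition c d) (at (?t u)) b) = vf_of c W (chart_inv d u) d"
        using q d assms(1) linear_Basis_expansion[OF jac_linear[OF assms(1) d q(3,2)], of "W (chart_map c q)"]
        by (simp add: vf_of_def tangent_of_def transition_chart_map)
    qed
  qed
  then show "smooth_on (chart_image d) (vf_rep d (vf_of c W))" by (simp add: vf_rep_def)
qed

section \<open>Vector fields as derivations\<close>

lemma smooth_fun_smooth: "smooth_fun A f \<Longrightarrow> c \<in> A \<Longrightarrow> smooth_on (chart_image c) (f \<circ> chart_inv c)"
  by (simp add: smooth_fun_def)

text \<open>The chart picked by \<open>chart_at\<close> may be replaced by any other: the Jacobian of the transition cancels
  against the transformation of the components of the vector.\<close>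

lemma vf_apply_chart:
  assumes "smooth_fun A f" "X \<in> vfields A" "c \<in> A" "p \<in> chart_dom c"
  shows "vf_apply A X f p = frechet_derivative (f \<circ> chart_inv c) (at (chart_map c p)) (X p c)"
proof -
  define d where "d = chart_at A p"
  have d: "d \<in> A" "p \<in> chart_dom d"
    unfolding d_def chart_at_def using someI[of "\<lambda>c. c \<in> A \<and> p \<in> chart_dom c" c] assms by auto
  have "((f \<circ> chart_inv c) has_derivative frechet_derivative (f \<circ> chart_inv c) (at (chart_map c p))) (at (transition d c (chart_map d p)))"
    using smooth_on_has_derivative[OF smooth_fun_smooth[OF assms(1,3)], of "chart_map c p"] assms d
    by (simp add: transition_chart_map)
  then have "((f \<circ> chart_inv c) \<circ> transition d c has_derivative
      frechet_derivative (f \<circ> chart_inv c) (at (chart_map c p)) \<circ> jac d c p) (at (chart_map d p))"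
    by (rule diff_chain_at[OF jac_has_derivative[OF d(1) assms(3) d(2) assms(4)]])
  then have "((f \<circ> chart_inv d) has_derivative
      frechet_derivative (f \<circ> chart_inv c) (at (chart_map c p)) \<circ> jac d c p) (at (chart_map d p))"
    by (rule has_derivative_transform_within_open[OF _ open_overlap[OF d(1) assms(3)]])
       (use assms d in \<open>auto simp: transition_def\<close>)
  then have eq: "frechet_derivative (f \<circ> chart_inv c) (at (chart_map c p)) \<circ> jac d c p
      = frechet_derivative (f \<circ> chart_inv d) (at (chart_map d p))"
    by (rule frechet_derivative_at)
  have "vf_apply A X f p = frechet_derivative (f \<circ> chart_inv d) (at (chart_map d p)) (X p d)"
    by (simp add: vf_apply_def d_def Let_def)
  also have "\<dots> = frechet_derivative (f \<circ> chart_inv c) (at (chart_map c p)) (jac d c p (X p d))"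
    by (simp add: eq[symmetric])
  also have "jac d c p (X p d) = X p c"
    using tangent_space_change_chart[OF vfields_tangent[OF assms(2)] d(1) assms(3) d(2) assms(4)] by simp
  finally show ?thesis .
qed

lemma vf_apply_chart_inv:
  assumes "smooth_fun A f" "X \<in> vfields A" "c \<in> A" "u \<in> chart_image c"
  shows "(vf_apply A X f \<circ> chart_inv c) u = frechet_derivative (f \<circ> chart_inv c) (at u) (vf_rep c X u)"
  using vf_apply_chart[OF assms(1-3), of "chart_inv c u"] assms(4) by (simp add: vf_rep_def)

lemma smooth_fun_vf_apply:
  assumes "smooth_fun A f" "X \<in> vfields A"
  shows "smooth_fun A (vf_apply A X f)"
  unfolding smooth_fun_def
proof
  fix c assume c: "c \<in> A"
  note fs = smooth_fun_smooth[OF assms(1) c]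
  have "smooth_on (chart_image c) (\<lambda>u. \<Sum>b\<in>Basis. (vf_rep c X u \<bullet> b) *\<^sub>R frechet_derivative (f \<circ> chart_inv c) (at u) b)"
    by (intro smooth_on_sum smooth_on_scaleR smooth_on_inner smooth_on_const open_chart_image c
        smooth_on_frechet_derivative fs vfields_smooth assms)
  then show "smooth_on (chart_image c) (vf_apply A X f \<circ> chart_inv c)"
  proof (rule smooth_on_cong[OF open_chart_image[OF c], rotated])
    fix u assume u: "u \<in> chart_image c"
    show "(\<Sum>b\<in>Basis. (vf_rep c X u \<bullet> b) *\<^sub>R frechet_derivative (f \<circ> chart_inv c) (at u) b) = (vf_apply A X f \<circ> chart_inv c) u"
      unfolding vf_apply_chart_inv[OF assms c u]
      by (rule linear_Basis_expansion[symmetric, OF has_derivative_linear[OF smooth_on_has_derivative[OF fs u]]])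
  qed
qed

text \<open>In \<open>X(Yf)\<close> the second derivative of \<open>f\<close> enters as \<open>D\<^sup>2f(X, Y)\<close>, which is symmetric. The difference leaves
  \<open>Df(DY X - DX Y)\<close>.\<close>

lemma lie_bracket_derivation:
  assumes f: "smooth_fun A f" and X: "X \<in> vfields A" and Y: "Y \<in> vfields A"
    and XY: "lie_bracket A X Y \<in> vfields A" and p: "c \<in> A" "p \<in> chart_dom c"
  shows "vf_apply A X (vf_apply A Y f) p - vf_apply A Y (vf_apply A X f) p = vf_apply A (lie_bracket A X Y) f p"
proof -
  let ?u = "chart_map c p"
  let ?F = "f \<circ> chart_inv c"
  have S: "open (chart_image c)" "?u \<in> chart_image c" using p open_chart_image by auto
  have Fs: "smooth_on (chart_image c) ?F" using smooth_fun_smooth f p by blast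
  have D: "vf_apply A V (vf_apply A W f) p =
      frechet_derivative ?F (at ?u) (frechet_derivative (vf_rep c W) (at ?u) (V p c))
      + frechet_derivative (\<lambda>y. frechet_derivative ?F (at y) (W p c)) (at ?u) (V p c)"
    if V: "V \<in> vfields A" and W: "W \<in> vfields A" for V W
  proof -
    have Wu: "vf_rep c W ?u = W p c" using p by (simp add: vf_rep_def)
    have "((\<lambda>y. frechet_derivative ?F (at y) (vf_rep c W y)) has_derivative
      (\<lambda>h. frechet_derivative ?F (at ?u) (frechet_derivative (vf_rep c W) (at ?u) h)
         + frechet_derivative (\<lambda>y. frechet_derivative ?F (at y) (W p c)) (at ?u) h)) (at ?u)"
      using has_derivative_frechet_derivative_along[OF S(1) Fs vfields_smooth[OF W p(1)] S(2)] Wu by simp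
    then have "((vf_apply A W f \<circ> chart_inv c) has_derivative
      (\<lambda>h. frechet_derivative ?F (at ?u) (frechet_derivative (vf_rep c W) (at ?u) h)
         + frechet_derivative (\<lambda>y. frechet_derivative ?F (at y) (W p c)) (at ?u) h)) (at ?u)"
      by (rule has_derivative_transform_within_open[OF _ S])
         (rule vf_apply_chart_inv[OF f W p(1), symmetric])
    note eq = frechet_derivative_at[OF this]
    show ?thesis
      unfolding vf_apply_chart[OF smooth_fun_vf_apply[OF f W] V p] eq[symmetric] by (rule refl)
  qed
  have lin: "linear (frechet_derivative ?F (at ?u))"
    using has_derivative_linear[OF smooth_on_has_derivative[OF Fs S(2)]] .
  have sym: "frechet_derivative (\<lambda>y. frechet_derivative ?F (at y) (Y p c)) (at ?u) (X p c)
     = frechet_derivative (\<lambda>y. frechet_derivative ?F (at y) (X p c)) (at ?u) (Y p c)"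
    using second_derivative_symmetric[OF S(1) _ S(2)] Fs unfolding smooth_on_def by blast
  show ?thesis
    unfolding D[OF X Y] D[OF Y X] vf_apply_chart[OF f XY p] sym
    using p by (simp add: lie_bracket_def linear_diff[OF lin])
qed

section \<open>Tensorial operators\<close>

lemma bump_at:
  assumes "c \<in> A" "p \<in> chart_dom c"
  obtains \<phi> r where "r > 0" "cball (chart_map c p) r \<subseteq> chart_image c" "smooth_on UNIV \<phi>"
    "\<phi> (chart_map c p) = (1::real)" "\<And>u. \<phi> u \<noteq> 0 \<longleftrightarrow> u \<in> ball (chart_map c p) r"
proof -
  have "chart_map c p \<in> chart_image c" using assms by blast
  then obtain r where r: "r > 0" "cball (chart_map c p) r \<subseteq> chart_image c"
    using open_chart_image[OF assms(1)] open_contains_cball by metis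
  obtain \<phi> where "smooth_on UNIV \<phi>" "\<phi> (chart_map c p) = (1::real)" "\<And>u. \<phi> u \<noteq> 0 \<longleftrightarrow> u \<in> ball (chart_map c p) r"
    using smooth_bump_exists[OF r(1)] by metis
  then show ?thesis using that r by blast
qed

text \<open>Linearity over the ring of smooth functions.\<close>

definition tensorial :: "(('m, 'n) vfield \<Rightarrow> ('m, 'n) vfield) \<Rightarrow> bool" where
  "tensorial T \<longleftrightarrow>
     (\<forall>X\<in>vfields A. \<forall>Y\<in>vfields A. T (vf_add X Y) = vf_add (T X) (T Y)) \<and>
     (\<forall>f. smooth_fun A f \<longrightarrow> (\<forall>X\<in>vfields A. T (vf_scale f X) = vf_scale f (T X)))"

lemma tensorial_lincomb:
  assumes "tensorial T" "finite I" "I \<noteq> {}" "\<And>i. i \<in> I \<Longrightarrow> smooth_fun A (f i)" "\<And>i. i \<in> I \<Longrightarrow> F i \<in> vfields A"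
  shows "T (vf_lincomb I f F) = vf_lincomb I f (\<lambda>i. T (F i))"
  using assms(2-5)
proof (induction I rule: finite_ne_induct)
  case (singleton i)
  then have "vf_lincomb {i} f F = vf_scale (f i) (F i)" "vf_lincomb {i} f (\<lambda>i. T (F i)) = vf_scale (f i) (T (F i))"
    by (simp_all add: vf_lincomb_def vf_scale_def)
  then show ?case using assms(1) singleton by (simp add: tensorial_def)
next
  case (insert i I)
  have "vf_lincomb I f F \<in> vfields A" "vf_scale (f i) (F i) \<in> vfields A"
    using insert by (auto intro!: vf_lincomb_vfields vf_scale_vfields)
  then show ?case
    using insert assms(1) by (simp add: vf_lincomb_insert tensorial_def)
qed

text \<open>Let \<open>\<phi>\<close> be a bump function with \<open>\<phi>(p) = 1\<close> and write \<open>X = \<phi>\<^sup>2 X + (1 - \<phi>\<^sup>2) X\<close>. The second term is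
  killed at \<open>p\<close> by its coefficient. The first is \<open>\<Sum>\<^sub>i (\<phi> X\<^sup>i) (\<phi> \<partial>\<^sub>i)\<close>, where the functions \<open>\<phi> X\<^sup>i\<close> and the
  fields \<open>\<phi> \<partial>\<^sub>i\<close> are defined on the whole manifold and \<open>X\<^sup>i(p) = 0\<close>.\<close>

lemma tensorial_zero_at:
  assumes T: "tensorial T" and X: "X \<in> vfields A" "X p = (\<lambda>d. 0)" and c: "c \<in> A" "p \<in> chart_dom c"
  shows "T X p = (\<lambda>d. 0)"
proof -
  obtain \<phi> r where \<phi>: "r > 0" "cball (chart_map c p) r \<subseteq> chart_image c" "smooth_on UNIV \<phi>"
    "\<phi> (chart_map c p) = (1::real)" "\<And>u. \<phi> u \<noteq> 0 \<longleftrightarrow> u \<in> ball (chart_map c p) r"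
    using bump_at[OF c] by metis
  have \<phi>0: "\<phi> u = 0" if "u \<notin> cball (chart_map c p) r" for u using that \<phi>(5)[of u] by auto
  have \<phi>s: "smooth_on (chart_image c) \<phi>" using \<phi>(3) smooth_on_subset by blast
  define cut where "cut = (\<lambda>q. if q \<in> chart_dom c then \<phi> (chart_map c q) else 0)"
  define frame where "frame = (\<lambda>i::'n. vf_of c (\<lambda>u. \<phi> u *\<^sub>R axis i 1))"
  define coef where "coef = (\<lambda>i q. if q \<in> chart_dom c then \<phi> (chart_map c q) * vf_rep c X (chart_map c q) $ i else 0)"
  have cut: "smooth_fun A cut"
    unfolding cut_def by (rule smooth_fun_extend[OF c(1) \<phi>(2) \<phi>s \<phi>0])
  have coef: "smooth_fun A (coef i)" for i
    unfolding coef_def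
  proof (rule smooth_fun_extend[OF c(1) \<phi>(2)])
    show "smooth_on (chart_image c) (\<lambda>u. \<phi> u * vf_rep c X u $ i)"
      using smooth_on_vec_iff[OF open_chart_image[OF c(1)], of "vf_rep c X"] vfields_smooth[OF X(1) c(1)]
      by (intro smooth_on_mult open_chart_image c \<phi>s) blast
  qed (use \<phi>0 in simp)
  have frame: "frame i \<in> vfields A" for i
    unfolding frame_def by (rule vf_of_vfields[OF c(1) \<phi>(2)])
      (use \<phi>0 \<phi>s c in \<open>auto intro!: smooth_on_scaleR smooth_on_const open_chart_image\<close>)
  \<comment> \<open>one factor \<open>cut\<close> extends the coefficients, the other the coordinate fields\<close>
  let ?Y = "vf_scale (\<lambda>q. cut q * cut q) X" and ?Z = "vf_scale (\<lambda>q. 1 + - 1 * (cut q * cut q)) X"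
  have cut2: "smooth_fun A (\<lambda>q. cut q * cut q)" by (rule smooth_fun_mult[OF cut cut])
  have cut2': "smooth_fun A (\<lambda>q. 1 + - 1 * (cut q * cut q))"
    by (rule smooth_fun_add[OF smooth_fun_const smooth_fun_mult[OF smooth_fun_const cut2]])
  have split: "X = vf_add ?Y ?Z" by (auto simp: vf_add_def vf_scale_def fun_eq_iff algebra_simps)
  have "?Y = vf_lincomb UNIV coef frame"
  proof
    fix q
    show "?Y q = vf_lincomb UNIV coef frame q"
    proof (cases "q \<in> chart_dom c")
      case False then show ?thesis by (simp add: vf_scale_def vf_lincomb_def cut_def coef_def)
    next
      case True
      have tY: "?Y q \<in> tangent_space A q" by (intro vfields_tangent vf_scale_vfields cut2 X)
      have tL: "vf_lincomb UNIV coef frame q \<in> tangent_space A q"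
        by (intro vfields_tangent vf_lincomb_vfields coef frame) auto
      have "vf_lincomb UNIV coef frame q c = (\<Sum>i\<in>UNIV. (cut q * cut q * X q c $ i) *\<^sub>R axis i 1)"
        using True c by (simp add: vf_lincomb_def coef_def frame_def vf_of_def cut_def vf_rep_def mult_ac)
      also have "\<dots> = (cut q * cut q) *\<^sub>R X q c"
        using basis_expansion[of "X q c"] by (simp add: scalar_mult_eq_scaleR flip: scaleR_scaleR scaleR_sum_right)
      finally show ?thesis
        by (intro tangent_space_eqI[OF tY tL c(1) True]) (simp add: vf_scale_def)
    qed
  qed
  then have "T ?Y = vf_lincomb UNIV coef (\<lambda>i. T (frame i))"
    using tensorial_lincomb[OF T, of UNIV coef frame] coef frame by simp
  moreover have "coef i p = 0" for i using X(2) c by (simp add: coef_def vf_rep_def)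
  ultimately have Y0: "T ?Y p = (\<lambda>d. 0)" by (simp add: vf_lincomb_def)
  have "T ?Z = vf_scale (\<lambda>q. 1 + - 1 * (cut q * cut q)) (T X)"
    using T cut2' X(1) unfolding tensorial_def by blast
  then have Z0: "T ?Z p = (\<lambda>d. 0)" using c \<phi>(4) by (simp add: vf_scale_def cut_def)
  have "T X = vf_add (T ?Y) (T ?Z)"
    using T vf_scale_vfields[OF cut2 X(1)] vf_scale_vfields[OF cut2' X(1)] split unfolding tensorial_def by metis
  then show ?thesis using Y0 Z0 by (simp add: vf_add_def)
qed

lemma tensorial_eq_at:
  assumes T: "tensorial T" and X: "X \<in> vfields A" "X' \<in> vfields A" "X p = X' p" and c: "c \<in> A" "p \<in> chart_dom c"
  shows "T X p = T X' p"
proof -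
  let ?m = "vf_scale (\<lambda>p. - 1) X'"
  have m: "?m \<in> vfields A" using X by (simp add: vf_scale_vfields smooth_fun_const)
  have "T (vf_add X ?m) p = (\<lambda>d. 0)"
    using m X by (intro tensorial_zero_at[OF T _ _ c] vf_add_vfields) (auto simp: vf_add_def vf_scale_def)
  moreover have "T (vf_add X ?m) = vf_add (T X) (vf_scale (\<lambda>p. - 1) (T X'))"
    using T X m smooth_fun_const unfolding tensorial_def by metis
  ultimately show ?thesis by (auto simp: vf_add_def vf_scale_def fun_eq_iff)
qed

end

section \<open>Curvature is a tensor\<close>

lemma matrix_works_linear:
  fixes f :: "real ^ 'n::finite \<Rightarrow> real ^ 'm::finite"
  assumes "linear f" shows "matrix f *v x = f x"
  by (rule matrix_works) (use assms in \<open>simp add: linear_matrix_vector_mul_eq\<close>)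

text \<open>Vanishing torsion expresses the bracket through the connection, and this is how the bracket inherits
  smoothness and its product rule from \<open>nabla\<close>.\<close>

locale affine_connection = atlas A
  for A :: "('m::{t2_space, second_countable_topology}, 'n::finite) chart set" +
  fixes nabla :: "('m, 'n) vfield \<Rightarrow> ('m, 'n) vfield \<Rightarrow> ('m, 'n) vfield"
  assumes connection: "connection A nabla" and torsion: "torsion_free A nabla"
begin

abbreviation R :: "('m, 'n) vfield \<Rightarrow> ('m, 'n) vfield \<Rightarrow> ('m, 'n) vfield \<Rightarrow> ('m, 'n) vfield" where
  "R \<equiv> curvature A nabla"

abbreviation lie :: "('m, 'n) vfield \<Rightarrow> ('m, 'n) vfield \<Rightarrow> ('m, 'n) vfield" where
  "lie \<equiv> lie_bracket A"

lemma nabla_vfields [simp]: "X \<in> vfields A \<Longrightarrow> Y \<in> vfields A \<Longrightarrow> nabla X Y \<in> vfields A"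
  using connection unfolding connection_def by blast

lemma nabla_add_left:
  "X \<in> vfields A \<Longrightarrow> X' \<in> vfields A \<Longrightarrow> Y \<in> vfields A \<Longrightarrow> nabla (vf_add X X') Y = vf_add (nabla X Y) (nabla X' Y)"
  using connection unfolding connection_def by blast

lemma nabla_add_right:
  "X \<in> vfields A \<Longrightarrow> Y \<in> vfields A \<Longrightarrow> Y' \<in> vfields A \<Longrightarrow> nabla X (vf_add Y Y') = vf_add (nabla X Y) (nabla X Y')"
  using connection unfolding connection_def by blast

lemma nabla_scale_left:
  "smooth_fun A f \<Longrightarrow> X \<in> vfields A \<Longrightarrow> Y \<in> vfields A \<Longrightarrow> nabla (vf_scale f X) Y = vf_scale f (nabla X Y)"
  using connection unfolding connection_def by blast

lemma nabla_scale_right: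
  "smooth_fun A f \<Longrightarrow> X \<in> vfields A \<Longrightarrow> Y \<in> vfields A \<Longrightarrow>
    nabla X (vf_scale f Y) = vf_add (vf_scale (vf_apply A X f) Y) (vf_scale f (nabla X Y))"
  using connection unfolding connection_def by blast

lemma lie_eq: "X \<in> vfields A \<Longrightarrow> Y \<in> vfields A \<Longrightarrow> lie X Y = vf_diff (nabla X Y) (nabla Y X)"
  using torsion unfolding torsion_free_def by simp

lemma lie_vfields [simp]: "X \<in> vfields A \<Longrightarrow> Y \<in> vfields A \<Longrightarrow> lie X Y \<in> vfields A"
  by (simp add: lie_eq vf_diff_vfields)

lemma R_vfields [simp]: "X \<in> vfields A \<Longrightarrow> Y \<in> vfields A \<Longrightarrow> Z \<in> vfields A \<Longrightarrow> R X Y Z \<in> vfields A"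
  unfolding curvature_def by (simp add: vf_diff_vfields)

lemmas vf_closed = vf_add_vfields vf_scale_vfields smooth_fun_const smooth_fun_vf_apply smooth_fun_mult

lemma R_swap:
  assumes "X \<in> vfields A" "Y \<in> vfields A" "Z \<in> vfields A"
  shows "R X Y Z = vf_scale (\<lambda>p. - 1) (R Y X Z)"
proof -
  have "lie X Y = vf_scale (\<lambda>p. - 1) (lie Y X)"
    using assms by (simp add: lie_eq vf_diff_def vf_scale_def)
  then have "nabla (lie X Y) Z = vf_scale (\<lambda>p. - 1) (nabla (lie Y X) Z)"
    using assms by (simp add: nabla_scale_left smooth_fun_const)
  then show ?thesis by (simp add: curvature_def vf_diff_def vf_scale_def fun_eq_iff)
qed

text \<open>The product rule for \<open>\<nabla>\<^sub>Y (f \<nabla>\<^sub>X Z)\<close> produces the term \<open>(Yf) \<nabla>\<^sub>X Z\<close>, which cancels against the one from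
  \<open>[fX, Y] = f [X, Y] - (Yf) X\<close>.\<close>

lemma tensorial_R_1:
  assumes Y: "Y \<in> vfields A" and Z: "Z \<in> vfields A"
  shows "tensorial (\<lambda>X. R X Y Z)"
  unfolding tensorial_def
proof (intro conjI ballI allI impI)
  fix X X' assume X: "X \<in> vfields A" and X': "X' \<in> vfields A"
  have "lie (vf_add X X') Y = vf_add (lie X Y) (lie X' Y)"
    using X X' Y by (simp add: lie_eq vf_closed nabla_add_left nabla_add_right)
      (simp add: vf_add_def vf_diff_def fun_eq_iff)
  then have "nabla (lie (vf_add X X') Y) Z = vf_add (nabla (lie X Y) Z) (nabla (lie X' Y) Z)"
    using X X' Y Z by (simp add: nabla_add_left)
  moreover have "nabla Y (nabla (vf_add X X') Z) = vf_add (nabla Y (nabla X Z)) (nabla Y (nabla X' Z))"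
    using X X' Y Z by (simp add: nabla_add_left nabla_add_right)
  moreover have "nabla (vf_add X X') (nabla Y Z) = vf_add (nabla X (nabla Y Z)) (nabla X' (nabla Y Z))"
    using X X' Y Z by (simp add: nabla_add_left)
  ultimately show "R (vf_add X X') Y Z = vf_add (R X Y Z) (R X' Y Z)"
    by (simp add: curvature_def) (simp add: vf_add_def vf_diff_def fun_eq_iff)
next
  fix f X assume f: "smooth_fun A f" and X: "X \<in> vfields A"
  let ?Yf = "vf_apply A Y f"
  have g: "smooth_fun A (\<lambda>p. - 1 * ?Yf p)" using f Y by (intro vf_closed)
  have "lie (vf_scale f X) Y = vf_add (vf_scale f (lie X Y)) (vf_scale (\<lambda>p. - 1 * ?Yf p) X)"
    using X Y f by (simp add: lie_eq vf_closed nabla_scale_left nabla_scale_right)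
      (simp add: vf_add_def vf_diff_def vf_scale_def fun_eq_iff algebra_simps)
  then have "nabla (lie (vf_scale f X) Y) Z = vf_add (vf_scale f (nabla (lie X Y) Z)) (vf_scale (\<lambda>p. - 1 * ?Yf p) (nabla X Z))"
    using X Y Z f g nabla_add_left[of "vf_scale f (lie X Y)" "vf_scale (\<lambda>p. - 1 * ?Yf p) X" Z]
      nabla_scale_left[OF g X Z] nabla_scale_left[OF f _ Z, of "lie X Y"] vf_scale_vfields[OF g X]
    by (simp add: vf_closed)
  moreover have "nabla Y (nabla (vf_scale f X) Z) = vf_add (vf_scale ?Yf (nabla X Z)) (vf_scale f (nabla Y (nabla X Z)))"
    using X Y Z f by (simp add: nabla_scale_left nabla_scale_right)
  moreover have "nabla (vf_scale f X) (nabla Y Z) = vf_scale f (nabla X (nabla Y Z))"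
    using X Y Z f by (simp add: nabla_scale_left)
  ultimately show "R (vf_scale f X) Y Z = vf_scale f (R X Y Z)"
    by (simp add: curvature_def) (simp add: vf_add_def vf_diff_def vf_scale_def fun_eq_iff algebra_simps)
qed

lemma tensorial_R_2:
  assumes X: "X \<in> vfields A" and Z: "Z \<in> vfields A"
  shows "tensorial (\<lambda>Y. R X Y Z)"
proof -
  note T = tensorial_R_1[OF X Z]
  have eq: "R X Y Z = vf_scale (\<lambda>p. - 1) (R Y X Z)" if "Y \<in> vfields A" for Y
    using R_swap[OF X that Z] .
  have "R X (vf_add Y Y') Z = vf_add (R X Y Z) (R X Y' Z)" if "Y \<in> vfields A" "Y' \<in> vfields A" for Y Y'
  proof -
    have "R (vf_add Y Y') X Z = vf_add (R Y X Z) (R Y' X Z)" using T that unfolding tensorial_def by blast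
    then show ?thesis using eq[OF vf_add_vfields[OF that]] eq[OF that(1)] eq[OF that(2)]
      by (simp add: vf_add_def vf_scale_def)
  qed
  moreover have "R X (vf_scale f Y) Z = vf_scale f (R X Y Z)" if "smooth_fun A f" "Y \<in> vfields A" for f Y
  proof -
    have "R (vf_scale f Y) X Z = vf_scale f (R Y X Z)" using T that unfolding tensorial_def by blast
    then show ?thesis using eq[OF vf_scale_vfields[OF that]] eq[OF that(2)]
      by (simp add: vf_scale_def)
  qed
  ultimately show ?thesis unfolding tensorial_def by blast
qed

text \<open>The first-order terms \<open>(Xf) \<nabla>\<^sub>Y Z + (Yf) \<nabla>\<^sub>X Z\<close> are symmetric and cancel; the coefficient of \<open>Z\<close> is
  \<open>X(Yf) - Y(Xf) - [X, Y]f = 0\<close>.\<close>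

lemma tensorial_R_3:
  assumes X: "X \<in> vfields A" and Y: "Y \<in> vfields A"
  shows "tensorial (\<lambda>Z. R X Y Z)"
  unfolding tensorial_def
proof (intro conjI ballI allI impI)
  fix Z Z' assume "Z \<in> vfields A" "Z' \<in> vfields A"
  then show "R X Y (vf_add Z Z') = vf_add (R X Y Z) (R X Y Z')"
    using X Y by (simp add: curvature_def nabla_add_right) (simp add: vf_add_def vf_diff_def fun_eq_iff)
next
  fix f Z assume f: "smooth_fun A f" and Z: "Z \<in> vfields A"
  have two: "nabla X (nabla Y (vf_scale f Z)) = vf_add
        (vf_add (vf_scale (vf_apply A X (vf_apply A Y f)) Z) (vf_scale (vf_apply A Y f) (nabla X Z)))
        (vf_add (vf_scale (vf_apply A X f) (nabla Y Z)) (vf_scale f (nabla X (nabla Y Z))))"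
    if X: "X \<in> vfields A" and Y: "Y \<in> vfields A" for X Y
    using X Y Z f by (simp add: nabla_scale_right nabla_add_right vf_closed)
  have one: "nabla (lie X Y) (vf_scale f Z) = vf_add (vf_scale (vf_apply A (lie X Y) f) Z) (vf_scale f (nabla (lie X Y) Z))"
    using X Y Z f by (simp add: nabla_scale_right)
  show "R X Y (vf_scale f Z) = vf_scale f (R X Y Z)"
  proof (intro ext)
    fix p c
    show "R X Y (vf_scale f Z) p c = vf_scale f (R X Y Z) p c"
    proof (cases "c \<in> A \<and> p \<in> chart_dom c")
      case False
      have "R X Y (vf_scale f Z) p c = 0" "vf_scale f (R X Y Z) p c = 0"
        using tangent_space_outside[OF vfields_tangent False] X Y Z f vf_closed by (simp_all add: vf_closed)
      then show ?thesis by simp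
    next
      case True
      have "vf_apply A X (vf_apply A Y f) p = vf_apply A (lie X Y) f p + vf_apply A Y (vf_apply A X f) p"
        using lie_bracket_derivation[OF f X Y _ conjunct1[OF True] conjunct2[OF True]] X Y by simp
      then show ?thesis
        unfolding curvature_def two[OF X Y] two[OF Y X] one
        by (simp add: vf_add_def vf_diff_def vf_scale_def algebra_simps)
    qed
  qed
qed

lemma curvature_at_eq:
  assumes X: "X \<in> vfields A" and Y: "Y \<in> vfields A" and Z: "Z \<in> vfields A" and p: "c \<in> A" "p \<in> chart_dom c"
  shows "curvature_at A nabla p (X p) (Y p) (Z p) = R X Y Z p"
  unfolding curvature_at_def
proof (rule the_equality)
  show "\<exists>X'\<in>vfields A. \<exists>Y'\<in>vfields A. \<exists>Z'\<in>vfields A. X' p = X p \<and> Y' p = Y p \<and> Z' p = Z p \<and> R X Y Z p = R X' Y' Z' p"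
    using X Y Z by blast
next
  fix w
  assume "\<exists>X'\<in>vfields A. \<exists>Y'\<in>vfields A. \<exists>Z'\<in>vfields A. X' p = X p \<and> Y' p = Y p \<and> Z' p = Z p \<and> w = R X' Y' Z' p"
  then obtain X' Y' Z' where v: "X' \<in> vfields A" "Y' \<in> vfields A" "Z' \<in> vfields A"
    and eq: "X' p = X p" "Y' p = Y p" "Z' p = Z p" and w: "w = R X' Y' Z' p" by blast
  have "R X' Y' Z' p = R X Y' Z' p"
    by (rule tensorial_eq_at[OF tensorial_R_1[OF v(2,3)] v(1) X eq(1) p])
  also have "\<dots> = R X Y Z' p"
    by (rule tensorial_eq_at[OF tensorial_R_2[OF X v(3)] v(2) Y eq(2) p])
  also have "\<dots> = R X Y Z p"
    by (rule tensorial_eq_at[OF tensorial_R_3[OF X Y] v(3) Z eq(3) p])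
  finally show "w = R X Y Z p" by (simp add: w)
qed

text \<open>\<open>G i j k\<close> are the component vectors, in the chart \<open>c\<close>, of the curvature applied to the coordinate
  fields \<open>\<partial>\<^sub>i\<close>, \<open>\<partial>\<^sub>j\<close>, \<open>\<partial>\<^sub>k\<close>, as smooth functions on the part \<open>V\<close> of the chart image.\<close>

definition curvature_components ::
    "('m, 'n) chart \<Rightarrow> (real ^ 'n) set \<Rightarrow> ('n \<Rightarrow> 'n \<Rightarrow> 'n \<Rightarrow> real ^ 'n \<Rightarrow> real ^ 'n) \<Rightarrow> bool" where
  "curvature_components c V G \<longleftrightarrow> open V \<and> V \<subseteq> chart_image c \<and> (\<forall>i j k. smooth_on V (G i j k)) \<and>
     (\<forall>q\<in>chart_dom c. chart_map c q \<in> V \<longrightarrow>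
       (\<forall>x\<in>tangent_space A q. \<forall>y\<in>tangent_space A q. \<forall>z\<in>tangent_space A q.
         curvature_at A nabla q x y z \<in> tangent_space A q \<and>
         curvature_at A nabla q x y z c =
           (\<Sum>i\<in>UNIV. x c $ i *\<^sub>R (\<Sum>j\<in>UNIV. y c $ j *\<^sub>R (\<Sum>k\<in>UNIV. z c $ k *\<^sub>R G i j k (chart_map c q))))))"

text \<open>The coordinate fields times a bump function \<open>\<phi>\<close> are vector fields \<open>F i\<close> on the whole manifold, and so is
  the curvature applied to them. Where \<open>\<phi>\<close> does not vanish, division by \<open>\<phi>\<^sup>3\<close> recovers the components.\<close>

lemma curvature_components_exist:
  assumes c: "c \<in> A" "p \<in> chart_dom c"
  obtains V G where "curvature_components c V G" "chart_map c p \<in> V"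
proof -
  obtain \<phi> r where \<phi>: "r > 0" "cball (chart_map c p) r \<subseteq> chart_image c" "smooth_on UNIV \<phi>"
    "\<phi> (chart_map c p) = (1::real)" "\<And>u. \<phi> u \<noteq> 0 \<longleftrightarrow> u \<in> ball (chart_map c p) r"
    using bump_at[OF c] by metis
  have \<phi>0: "\<phi> u = 0" if "u \<notin> cball (chart_map c p) r" for u using that \<phi>(5)[of u] by auto
  have \<phi>s: "smooth_on S \<phi>" for S using \<phi>(3) smooth_on_subset by blast
  define F where "F = (\<lambda>i::'n. vf_of c (\<lambda>u. \<phi> u *\<^sub>R axis i 1))"
  have F: "F i \<in> vfields A" for i
    unfolding F_def by (rule vf_of_vfields[OF c(1) \<phi>(2)])
      (use \<phi>0 \<phi>s c in \<open>auto intro!: smooth_on_scaleR smooth_on_const open_chart_image\<close>)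
  define V where "V = ball (chart_map c p) r"
  define G where "G = (\<lambda>i j k u. (inverse (\<phi> u) * inverse (\<phi> u) * inverse (\<phi> u)) *\<^sub>R vf_rep c (R (F i) (F j) (F k)) u)"
  have V: "open V" "chart_map c p \<in> V" "V \<subseteq> chart_image c"
    using \<phi>(1,2) by (auto simp: V_def)
  have G: "smooth_on V (G i j k)" for i j k
  proof -
    have "smooth_on V (\<lambda>u. inverse (\<phi> u))"
      using \<phi>(5) by (intro smooth_on_inverse V \<phi>s) (auto simp: V_def)
    moreover have "smooth_on V (vf_rep c (R (F i) (F j) (F k)))"
      by (rule smooth_on_subset[OF vfields_smooth[OF _ c(1)] V(3)]) (simp add: F)
    ultimately show ?thesis unfolding G_def by (intro smooth_on_scaleR smooth_on_mult V)
  qed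
  define E where "E = (\<lambda>w::real ^ 'n. vf_lincomb UNIV (\<lambda>i q. w $ i) F)"
  have E: "E w \<in> vfields A" for w
    unfolding E_def by (rule vf_lincomb_vfields) (auto simp: F smooth_fun_const)
  have T: "T (E w) = vf_lincomb UNIV (\<lambda>i q. w $ i) (\<lambda>i. T (F i))" if "tensorial T" for T w
    unfolding E_def by (rule tensorial_lincomb[OF that]) (auto simp: F smooth_fun_const)
  have *: "curvature_at A nabla q x y z \<in> tangent_space A q \<and>
       curvature_at A nabla q x y z c =
         (\<Sum>i\<in>UNIV. x c $ i *\<^sub>R (\<Sum>j\<in>UNIV. y c $ j *\<^sub>R (\<Sum>k\<in>UNIV. z c $ k *\<^sub>R G i j k (chart_map c q))))"
    if q: "q \<in> chart_dom c" "chart_map c q \<in> V"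
      and xyz: "x \<in> tangent_space A q" "y \<in> tangent_space A q" "z \<in> tangent_space A q" for q x y z
  proof -
    let ?t = "inverse (\<phi> (chart_map c q))"
    have nz: "\<phi> (chart_map c q) \<noteq> 0" using q \<phi>(5) by (simp add: V_def)
    have Eq: "E (?t *\<^sub>R w c) q = w" if w: "w \<in> tangent_space A q" for w
    proof (rule tangent_space_eqI[OF vfields_tangent[OF E] w c(1) q(1)])
      have "E (?t *\<^sub>R w c) q c = (\<Sum>i\<in>UNIV. w c $ i *\<^sub>R axis i 1)"
        using nz q c by (simp add: E_def vf_lincomb_def F_def vf_of_def field_simps)
      then show "E (?t *\<^sub>R w c) q c = w c"
        using basis_expansion[of "w c"] by (simp only: scalar_mult_eq_scaleR)
    qed
    let ?X = "E (?t *\<^sub>R x c)" and ?Y = "E (?t *\<^sub>R y c)" and ?Z = "E (?t *\<^sub>R z c)"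
    have at: "curvature_at A nabla q x y z = R ?X ?Y ?Z q"
      using curvature_at_eq[OF E E E c(1) q(1), of "?t *\<^sub>R x c" "?t *\<^sub>R y c" "?t *\<^sub>R z c"]
      by (simp only: Eq xyz)
    have "R ?X ?Y ?Z = vf_lincomb UNIV (\<lambda>i q. (?t *\<^sub>R x c) $ i) (\<lambda>i. R (F i) ?Y ?Z)"
      by (rule T[OF tensorial_R_1[OF E E]])
    also have "\<dots> = vf_lincomb UNIV (\<lambda>i q. (?t *\<^sub>R x c) $ i) (\<lambda>i. vf_lincomb UNIV (\<lambda>j q. (?t *\<^sub>R y c) $ j) (\<lambda>j. R (F i) (F j) ?Z))"
      by (simp only: T[OF tensorial_R_2[OF F E]])
    also have "\<dots> = vf_lincomb UNIV (\<lambda>i q. (?t *\<^sub>R x c) $ i) (\<lambda>i. vf_lincomb UNIV (\<lambda>j q. (?t *\<^sub>R y c) $ j) (\<lambda>j.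
        vf_lincomb UNIV (\<lambda>k q. (?t *\<^sub>R z c) $ k) (\<lambda>k. R (F i) (F j) (F k))))"
      by (simp only: T[OF tensorial_R_3[OF F F]])
    finally have "R ?X ?Y ?Z q c = (\<Sum>i\<in>UNIV. (?t * x c $ i) *\<^sub>R (\<Sum>j\<in>UNIV. (?t * y c $ j) *\<^sub>R (\<Sum>k\<in>UNIV. (?t * z c $ k) *\<^sub>R R (F i) (F j) (F k) q c)))"
      by (simp add: vf_lincomb_def)
    also have "\<dots> = (\<Sum>i\<in>UNIV. x c $ i *\<^sub>R (\<Sum>j\<in>UNIV. y c $ j *\<^sub>R (\<Sum>k\<in>UNIV. z c $ k *\<^sub>R G i j k (chart_map c q))))"
      using q c by (simp add: G_def vf_rep_def scaleR_sum_right mult_ac)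
    finally show ?thesis using at vfields_tangent[OF R_vfields[OF E E E]] by simp
  qed
  have "curvature_components c V G"
    unfolding curvature_components_def using V(1,3) G * by blast
  then show ?thesis using V(2) by (rule that)
qed

section \<open>The matrix of the Jacobi operator\<close>

text \<open>The same matrix as in \<open>endo_matrix\<close>, but in a chart of choice: the chart picked by \<open>chart_at\<close> can
  jump from point to point, so smoothness has to be seen in a fixed one.\<close>

definition jacobi_matrix :: "('m, 'n) chart \<Rightarrow> ('m, 'n) tpoint \<Rightarrow> real ^ 'n ^ 'n" where
  "jacobi_matrix c x = matrix (\<lambda>u. jacobi A nabla x (tangent_of A c (fst x) u) c)"

lemma jacobi_in_tangent_space:
  assumes "x \<in> TM A" "y \<in> tangent_space A (fst x)"
  shows "jacobi A nabla x y \<in> tangent_space A (fst x)"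
proof -
  obtain c where c: "c \<in> A" "fst x \<in> chart_dom c" and v: "snd x \<in> tangent_space A (fst x)"
    using assms(1) by (auto simp: TM_def)
  obtain V G where "curvature_components c V G" "chart_map c (fst x) \<in> V"
    using curvature_components_exist[OF c] .
  then show ?thesis
    unfolding jacobi_def curvature_components_def using c v assms(2) by blast
qed

lemma jacobi_component_linear:
  assumes "x \<in> TM A" "c \<in> A" "fst x \<in> chart_dom c"
  shows "linear (\<lambda>u. jacobi A nabla x (tangent_of A c (fst x) u) c)"
proof -
  have v: "snd x \<in> tangent_space A (fst x)" using assms(1) by (auto simp: TM_def)
  obtain V G where G: "curvature_components c V G" and V: "chart_map c (fst x) \<in> V"
    using curvature_components_exist[OF assms(2,3)] .
  have "jacobi A nabla x (tangent_of A c (fst x) u) c =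
     (\<Sum>i\<in>UNIV. u $ i *\<^sub>R (\<Sum>j\<in>UNIV. snd x c $ j *\<^sub>R (\<Sum>k\<in>UNIV. snd x c $ k *\<^sub>R G i j k (chart_map c (fst x)))))" for u
  proof -
    have "jacobi A nabla x (tangent_of A c (fst x) u) c =
     (\<Sum>i\<in>UNIV. tangent_of A c (fst x) u c $ i *\<^sub>R (\<Sum>j\<in>UNIV. snd x c $ j *\<^sub>R (\<Sum>k\<in>UNIV. snd x c $ k *\<^sub>R G i j k (chart_map c (fst x)))))"
      using G assms(3) V tangent_of_in_tangent_space[OF assms(2,3), of u] v
      unfolding jacobi_def curvature_components_def by blast
    then show ?thesis using assms by simp
  qed
  moreover have "linear (\<lambda>u. \<Sum>i\<in>UNIV. u $ i *\<^sub>R H i)" for H :: "'n \<Rightarrow> real ^ 'n"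
    by (intro linearI) (simp_all add: scaleR_add_left sum.distrib scaleR_sum_right)
  ultimately show ?thesis by simp
qed

lemma jacobi_component:
  assumes "x \<in> TM A" "c \<in> A" "fst x \<in> chart_dom c" "y \<in> tangent_space A (fst x)"
  shows "jacobi A nabla x y c = jacobi_matrix c x *v y c"
  using matrix_works_linear[OF jacobi_component_linear[OF assms(1-3)], of "y c"] tangent_of_component[OF assms(2-4)]
  by (simp add: jacobi_matrix_def)

lemma jacobi_power:
  assumes "x \<in> TM A" "c \<in> A" "fst x \<in> chart_dom c" "y \<in> tangent_space A (fst x)"
  shows "(jacobi A nabla x ^^ k) y \<in> tangent_space A (fst x) \<and>
    (jacobi A nabla x ^^ k) y c = matpow (jacobi_matrix c x) k *v y c"
proof (induction k)
  case (Suc k)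
  then show ?case
    using assms by (simp add: jacobi_in_tangent_space jacobi_component matrix_vector_mul_assoc)
qed (use assms in simp)

lemma chart_at:
  assumes "x \<in> TM A"
  shows "chart_at A (fst x) \<in> A" "fst x \<in> chart_dom (chart_at A (fst x))"
proof -
  obtain c where "c \<in> A \<and> fst x \<in> chart_dom c" using assms by (auto simp: TM_def)
  from someI[of "\<lambda>c. c \<in> A \<and> fst x \<in> chart_dom c", OF this]
  show "chart_at A (fst x) \<in> A" "fst x \<in> chart_dom (chart_at A (fst x))"
    by (simp_all add: chart_at_def)
qed

lemma endo_matrix_jacobi_power:
  assumes "x \<in> TM A"
  shows "endo_matrix A (fst x) (jacobi A nabla x ^^ k) = matpow (jacobi_matrix (chart_at A (fst x)) x) k"
proof -
  let ?c = "chart_at A (fst x)"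
  have "(jacobi A nabla x ^^ k) (tangent_of A ?c (fst x) u) ?c = matpow (jacobi_matrix ?c x) k *v u" for u
    using jacobi_power[OF assms chart_at[OF assms] tangent_of_in_tangent_space[OF chart_at[OF assms]]]
      tangent_of_apply[OF chart_at[OF assms]] by simp
  then show ?thesis
    by (simp add: endo_matrix_def Let_def matrix_of_matrix_vector_mul)
qed

text \<open>The conjugating matrices are the Jacobians of the two transition maps.\<close>

lemma jacobi_matrix_change_chart:
  assumes x: "x \<in> TM A" and c: "c \<in> A" "fst x \<in> chart_dom c" and d: "d \<in> A" "fst x \<in> chart_dom d"
  obtains P Q where "P ** Q = mat 1" "Q ** P = mat 1" "jacobi_matrix d x = P ** jacobi_matrix c x ** Q"
proof
  let ?P = "matrix (jac c d (fst x))" and ?Q = "matrix (jac d c (fst x))"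
  have P: "?P *v v = jac c d (fst x) v" and Q: "?Q *v v = jac d c (fst x) v" for v
    by (rule matrix_works_linear, rule jac_linear, use c d in simp_all)+
  show "?P ** ?Q = mat 1"
    unfolding matrix_eq using c d
    by (simp add: matrix_vector_mul_assoc[symmetric] P Q jac_compose jac_self)
  show "?Q ** ?P = mat 1"
    unfolding matrix_eq using c d
    by (simp add: matrix_vector_mul_assoc[symmetric] P Q jac_compose jac_self)
  have "jacobi_matrix d x *v v = (?P ** jacobi_matrix c x ** ?Q) *v v" for v
  proof -
    let ?y = "tangent_of A d (fst x) v"
    have y: "?y \<in> tangent_space A (fst x)" by (rule tangent_of_in_tangent_space[OF d])
    have "jacobi_matrix d x *v v = jacobi A nabla x ?y d"
      using jacobi_component[OF x d y] d by simp
    also have "\<dots> = jac c d (fst x) (jacobi A nabla x ?y c)"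
      by (rule tangent_space_change_chart[OF jacobi_in_tangent_space[OF x y] c(1) d(1) c(2) d(2)])
    also have "\<dots> = ?P *v (jacobi_matrix c x *v ?y c)"
      by (simp add: P jacobi_component[OF x c y])
    also have "?y c = ?Q *v v"
      using tangent_space_change_chart[OF y d(1) c(1) d(2) c(2)] d by (simp add: Q)
    finally show ?thesis by (simp add: matrix_vector_mul_assoc matrix_mul_assoc)
  qed
  then show "jacobi_matrix d x = ?P ** jacobi_matrix c x ** ?Q" unfolding matrix_eq by blast
qed

lemma trace_matpow_change_chart:
  assumes x: "x \<in> TM A" and c: "c \<in> A" "fst x \<in> chart_dom c" and d: "d \<in> A" "fst x \<in> chart_dom d"
  shows "trace (matpow (jacobi_matrix d x) k) = trace (matpow (jacobi_matrix c x) k)"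
proof -
  obtain P Q where PQ: "P ** Q = mat 1" "Q ** P = mat 1" "jacobi_matrix d x = P ** jacobi_matrix c x ** Q"
    using jacobi_matrix_change_chart[OF assms] .
  let ?B = "jacobi_matrix c x"
  have "matpow (P ** ?B ** Q) k = P ** matpow ?B k ** Q"
  proof (induction k)
    case (Suc k)
    have "matpow (P ** ?B ** Q) (Suc k) = P ** ?B ** (Q ** P) ** matpow ?B k ** Q"
      by (simp add: Suc matrix_mul_assoc)
    then show ?case by (simp add: PQ matrix_mul_assoc)
  qed (simp add: PQ)
  then have "trace (matpow (jacobi_matrix d x) k) = trace (P ** (matpow ?B k ** Q))"
    by (simp add: PQ(3) matrix_mul_assoc)
  also have "\<dots> = trace (matpow ?B k ** (Q ** P))"
    by (subst trace_mul_sym) (simp add: matrix_mul_assoc)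
  finally show ?thesis by (simp add: PQ)
qed

lemma TM_chart_inv_in_TM:
  assumes "c \<in> A" "fst a \<in> chart_image c"
  shows "TM_chart_inv A c a \<in> TM A" "fst (TM_chart_inv A c a) \<in> chart_dom c"
  using assms by (auto simp: TM_def TM_chart_inv_def tangent_of_in_tangent_space)

lemma jacobi_matrix_smooth:
  assumes c: "c \<in> A"
  shows "smooth_on (chart_image c \<times> UNIV) (\<lambda>a. jacobi_matrix c (TM_chart_inv A c a) $ i $ j)"
proof (rule smooth_on_local)
  fix a :: "(real ^ 'n) \<times> (real ^ 'n)" assume a: "a \<in> chart_image c \<times> UNIV"
  define p where "p = chart_inv c (fst a)"
  have p: "p \<in> chart_dom c" "chart_map c p = fst a" using a by (auto simp: p_def)
  obtain V G where VG: "curvature_components c V G" and pV: "chart_map c p \<in> V"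
    using curvature_components_exist[OF c p(1)] .
  have V: "open V" "chart_map c p \<in> V" "V \<subseteq> chart_image c" and Gs: "smooth_on V (G i j k)" for i j k
    using VG pV unfolding curvature_components_def by blast+
  have op: "open (V \<times> (UNIV :: (real ^ 'n) set))" using V(1) by (simp add: open_Times)
  have eq: "jacobi_matrix c (TM_chart_inv A c b) $ i $ j =
      (\<Sum>l\<in>UNIV. snd b $ l * (\<Sum>k\<in>UNIV. snd b $ k * G j l k (fst b) $ i))"
    if b: "b \<in> V \<times> UNIV" for b
  proof -
    let ?q = "chart_inv c (fst b)"
    have q: "?q \<in> chart_dom c" "chart_map c ?q = fst b" "fst b \<in> V" using b V(3) by auto
    have qV: "chart_map c ?q \<in> V" using q by simp
    let ?v = "tangent_of A c ?q (snd b)" and ?e = "tangent_of A c ?q (axis j 1)"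
    have t: "?v \<in> tangent_space A ?q" "?e \<in> tangent_space A ?q"
      using tangent_of_in_tangent_space[OF c q(1)] by auto
    have "jacobi_matrix c (TM_chart_inv A c b) $ i $ j = curvature_at A nabla ?q ?e ?v ?v c $ i"
      by (simp add: jacobi_matrix_def matrix_def TM_chart_inv_def jacobi_def)
    also have "\<dots> = (\<Sum>i'\<in>UNIV. axis j 1 $ i' *\<^sub>R (\<Sum>l\<in>UNIV. snd b $ l *\<^sub>R (\<Sum>k\<in>UNIV. snd b $ k *\<^sub>R G i' l k (fst b)))) $ i"
    proof -
      have "curvature_at A nabla ?q ?e ?v ?v c =
        (\<Sum>i\<in>UNIV. ?e c $ i *\<^sub>R (\<Sum>j\<in>UNIV. ?v c $ j *\<^sub>R (\<Sum>k\<in>UNIV. ?v c $ k *\<^sub>R G i j k (chart_map c ?q))))"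
        using VG q(1) qV t unfolding curvature_components_def by blast
      then show ?thesis using q(1,2) c by simp
    qed
    also have "(\<Sum>i'\<in>UNIV. axis j 1 $ i' *\<^sub>R (\<Sum>l\<in>UNIV. snd b $ l *\<^sub>R (\<Sum>k\<in>UNIV. snd b $ k *\<^sub>R G i' l k (fst b))))
       = (\<Sum>i'\<in>UNIV. if i' = j then (\<Sum>l\<in>UNIV. snd b $ l *\<^sub>R (\<Sum>k\<in>UNIV. snd b $ k *\<^sub>R G i' l k (fst b))) else 0)"
      by (rule sum.cong) (auto simp: axis_def)
    finally show ?thesis by simp
  qed
  have comp: "smooth_on (V \<times> UNIV) (\<lambda>b :: (real ^ 'n) \<times> (real ^ 'n). snd b $ l)" for l
    by (intro smooth_on_bounded_linear op bounded_linear_compose[OF bounded_linear_vec_nth bounded_linear_snd])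
  have Gc: "smooth_on (V \<times> UNIV) (\<lambda>b :: (real ^ 'n) \<times> (real ^ 'n). G j l k (fst b) $ i)" for l k
    by (rule smooth_on_compose[OF op V(1) smooth_on_bounded_linear[OF op bounded_linear_fst], of "\<lambda>u. G j l k u $ i"])
       (use smooth_on_vec_iff[OF V(1), THEN iffD1, OF Gs] in auto)
  have "smooth_on (V \<times> UNIV) (\<lambda>b. \<Sum>l\<in>UNIV. snd b $ l * (\<Sum>k\<in>UNIV. snd b $ k * G j l k (fst b) $ i))"
    by (intro smooth_on_sum smooth_on_mult op comp Gc)
  then have "smooth_on (V \<times> UNIV) (\<lambda>a. jacobi_matrix c (TM_chart_inv A c a) $ i $ j)"
    by (rule smooth_on_cong[OF op, rotated]) (use eq in simp)
  moreover have "a \<in> V \<times> UNIV" using V(2) p by (cases a) auto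
  ultimately show "\<exists>U. open U \<and> a \<in> U \<and> smooth_on U (\<lambda>a. jacobi_matrix c (TM_chart_inv A c a) $ i $ j)"
    using op by blast
qed

end

lemma smooth_on_matpow:
  fixes M :: "'a::euclidean_space \<Rightarrow> real ^ 'n ^ 'n::finite"
  assumes "open S" "\<And>i j. smooth_on S (\<lambda>a. M a $ i $ j)"
  shows "smooth_on S (\<lambda>a. matpow (M a) k $ i $ j)"
proof (induction k arbitrary: i j)
  case 0
  then show ?case using assms(1) by (simp add: Finite_Cartesian_Product.mat_def smooth_on_const)
next
  case (Suc k)
  then show ?case
    by (simp add: matrix_matrix_mult_def) (intro smooth_on_sum smooth_on_mult assms)
qed

lemma smooth_on_trace_matpow:
  fixes M :: "'a::euclidean_space \<Rightarrow> real ^ 'n ^ 'n::finite"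
  assumes "open S" "\<And>i j. smooth_on S (\<lambda>a. M a $ i $ j)"
  shows "smooth_on S (\<lambda>a. trace (matpow (M a) k))"
  unfolding trace_def by (intro smooth_on_sum smooth_on_matpow assms)

section \<open>Proportional spectra\<close>

text \<open>The situation of the theorem, with \<open>W\<close> for the connected open set.\<close>

locale proportional_spectra = affine_connection A nabla
  for A :: "('m::{t2_space, second_countable_topology}, 'n::finite) chart set" and nabla +
  fixes W :: "('m, 'n) tpoint set" and s :: "('m, 'n) tpoint \<Rightarrow> ('m, 'n) tpoint \<Rightarrow> real"
  assumes open_W: "openin (TM_topology A) W"
    and connected_W: "connectedin (TM_topology A) W"
    and proportional: "\<And>x y. x \<in> W \<Longrightarrow> y \<in> W \<Longrightarrow>
      Spec A (fst x) (jacobi A nabla x)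
        = (\<lambda>z. complex_of_real (s x y) * z) ` Spec A (fst y) (jacobi A nabla y) \<and>
      (\<lambda>z. complex_of_real (s x y) * z) ` Spec A (fst y) (jacobi A nabla y) \<noteq> {0}"
begin

definition eigs :: "('m, 'n) tpoint \<Rightarrow> complex multiset" where
  "eigs x = Spec_mset A (fst x) (jacobi A nabla x)"

definition power_trace :: "nat \<Rightarrow> ('m, 'n) tpoint \<Rightarrow> real" where
  "power_trace k x = Tr A (fst x) (jacobi A nabla x ^^ k)"

lemma in_TM: "x \<in> W \<Longrightarrow> x \<in> TM A"
  using open_W unfolding openin_TM_topology by blast

lemma endo_matrix_jacobi:
  "x \<in> W \<Longrightarrow> endo_matrix A (fst x) (jacobi A nabla x) = jacobi_matrix (chart_at A (fst x)) x"
  using endo_matrix_jacobi_power[OF in_TM, of x 1] by simp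

lemma eigs_eq: "x \<in> W \<Longrightarrow> eigs x = eigenvalues (jacobi_matrix (chart_at A (fst x)) x)"
  by (simp add: eigs_def Spec_mset_def eigenvalues_def endo_matrix_jacobi)

lemma Spec_eq: "x \<in> W \<Longrightarrow> Spec A (fst x) (jacobi A nabla x) = set_mset (eigs x)"
  by (simp add: Spec_def set_eigenvalues eigs_eq endo_matrix_jacobi)

lemma power_trace_eq_chart:
  assumes "x \<in> W" "c \<in> A" "fst x \<in> chart_dom c"
  shows "power_trace k x = trace (matpow (jacobi_matrix c x) k)"
  using trace_matpow_change_chart[OF in_TM[OF assms(1)] assms(2,3) chart_at[OF in_TM[OF assms(1)]]]
  by (simp add: power_trace_def Tr_def endo_matrix_jacobi_power in_TM assms)

lemma power_trace_eigs: "x \<in> W \<Longrightarrow> complex_of_real (power_trace k x) = (\<Sum>e\<in>#eigs x. e ^ k)"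
  using power_trace_eq_chart[OF _ chart_at[OF in_TM], of x k] by (simp add: eigs_eq trace_eigenvalues)

text \<open>Conjugate matrices have equal power traces, and these determine the eigenvalues.\<close>

lemma eigs_eq_chart:
  assumes "x \<in> W" "c \<in> A" "fst x \<in> chart_dom c"
  shows "eigs x = eigenvalues (jacobi_matrix c x)"
  by (rule mset_eq_of_power_sums) (simp add: power_trace_eigs[OF assms(1), symmetric] power_trace_eq_chart[OF assms] trace_eigenvalues)

lemma size_eigs: "x \<in> W \<Longrightarrow> size (eigs x) = CARD('n)"
  by (simp add: eigs_eq size_eigenvalues)

lemma eigs_nonempty: "x \<in> W \<Longrightarrow> eigs x \<noteq> {#}"
  using size_eigs by fastforce

lemma set_eigs_scale:
  "x \<in> W \<Longrightarrow> y \<in> W \<Longrightarrow> set_mset (eigs x) = (\<lambda>z. complex_of_real (s x y) * z) ` set_mset (eigs y)"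
  using proportional[of x y] by (simp add: Spec_eq)

lemma eigs_nonzero:
  assumes "x \<in> W"
  obtains z where "z \<in># eigs x" "z \<noteq> 0"
proof -
  have "Spec A (fst x) (jacobi A nabla x) \<noteq> {0}" using proportional[OF assms assms] by metis
  then have "set_mset (eigs x) \<noteq> {0}" by (simp add: Spec_eq assms)
  moreover have "set_mset (eigs x) \<noteq> {}" using eigs_nonempty[OF assms] by simp
  ultimately show ?thesis using that by blast
qed

abbreviation \<rho> :: "('m, 'n) tpoint \<Rightarrow> real" where
  "\<rho> x \<equiv> spectral_radius (eigs x)"

lemma \<rho>_pos: "x \<in> W \<Longrightarrow> \<rho> x > 0"
  using eigs_nonzero spectral_radius_pos by metis

lemma \<rho>_scale: "x \<in> W \<Longrightarrow> y \<in> W \<Longrightarrow> \<rho> x = \<bar>s x y\<bar> * \<rho> y"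
  by (rule spectral_radius_scale[OF set_eigs_scale eigs_nonempty])

abbreviation chart_part :: "('m, 'n) chart \<Rightarrow> ((real ^ 'n) \<times> (real ^ 'n)) set" where
  "chart_part c \<equiv> TM_chart_part A c W"

lemma part_open: "c \<in> A \<Longrightarrow> open (chart_part c)"
  using open_W unfolding openin_TM_topology by blast

lemma part_facts:
  assumes "c \<in> A" "a \<in> chart_part c"
  shows "TM_chart_inv A c a \<in> W" "fst (TM_chart_inv A c a) \<in> chart_dom c"
  using assms TM_chart_inv_in_TM[OF assms(1), of a] by (auto simp: TM_chart_part_def)

lemma jacobi_matrix_smooth_part:
  "c \<in> A \<Longrightarrow> smooth_on (chart_part c) (\<lambda>a. jacobi_matrix c (TM_chart_inv A c a) $ i $ j)"
  by (rule smooth_on_subset[OF jacobi_matrix_smooth]) (auto simp: TM_chart_part_def)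

lemma power_trace_smooth_part:
  assumes "c \<in> A"
  shows "smooth_on (chart_part c) (\<lambda>a. power_trace k (TM_chart_inv A c a))"
  by (rule smooth_on_cong[OF part_open[OF assms] _ smooth_on_trace_matpow[OF part_open[OF assms] jacobi_matrix_smooth_part[OF assms]]])
     (use power_trace_eq_chart part_facts assms in simp)

text \<open>In a bundle chart the characteristic polynomial, evaluated at a fixed eigenvalue \<open>z\<close> of the centre, is
  continuous and vanishes at the centre. So it is small nearby, and there is an eigenvalue near \<open>z\<close>.\<close>

lemma eigs_near:
  assumes c: "c \<in> A" and a: "a \<in> chart_part c" and z: "z \<in># eigs (TM_chart_inv A c a)" and \<delta>: "\<delta> > 0"
  shows "\<forall>\<^sub>F b in at a. \<exists>e. e \<in># eigs (TM_chart_inv A c b) \<and> norm (e - z) < \<delta>"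
proof -
  let ?M = "\<lambda>b. jacobi_matrix c (TM_chart_inv A c b)"
  let ?p = "\<lambda>b. poly (charpoly (?M b)) z"
  have entries: "continuous_on (chart_part c) (\<lambda>b. ?M b $ i $ j)" for i j
    by (rule smooth_on_continuous_on[OF jacobi_matrix_smooth_part[OF c]])
  have "continuous_on (chart_part c) ?p"
    unfolding poly_charpoly Determinants.det_def map_matrix_def Finite_Cartesian_Product.mat_def
    by (simp, intro continuous_intros entries)
  then have "isCont ?p a"
    using continuous_on_eq_continuous_at[OF part_open[OF c]] a by blast
  then have lim: "(?p \<longlongrightarrow> ?p a) (at a)" by (rule isContD)
  have "?p a = 0"
    using z eigs_eq_chart[OF part_facts(1)[OF c a] c part_facts(2)[OF c a]] set_eigenvalues[of "?M a"] by auto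
  then have "\<forall>\<^sub>F b in at a. dist (?p b) 0 < \<delta> ^ CARD('n)"
    using tendstoD[OF lim, of "\<delta> ^ CARD('n)"] \<delta> by (simp only: zero_less_power)
  moreover have "\<forall>\<^sub>F b in at a. b \<in> chart_part c"
    using part_open[OF c] a by (rule eventually_at_in_open')
  ultimately show ?thesis
  proof eventually_elim
    case (elim b)
    obtain e where e: "e \<in># eigenvalues (?M b)" "norm (e - z) ^ CARD('n) \<le> norm (?p b)"
      by (rule eigenvalue_near)
    have "norm (e - z) ^ CARD('n) < \<delta> ^ CARD('n)" using e(2) elim(1) by simp
    then have "norm (e - z) < \<delta>" using \<delta> power_less_imp_less_base by fastforce
    then show ?case
      using e(1) eigs_eq_chart[OF part_facts(1)[OF c elim(2)] c part_facts(2)[OF c elim(2)]] by auto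
  qed
qed

lemma \<rho>_continuous_part:
  assumes c: "c \<in> A"
  shows "continuous_on (chart_part c) (\<lambda>a. \<rho> (TM_chart_inv A c a))"
proof (intro continuous_at_imp_continuous_on ballI)
  fix a assume a: "a \<in> chart_part c"
  note x = part_facts(1)[OF c a]
  obtain z where z: "z \<in># eigs (TM_chart_inv A c a)" "z \<noteq> 0" using eigs_nonzero[OF x] .
  have "\<forall>\<^sub>F b in at a. b \<in> chart_part c"
    using part_open[OF c] a by (rule eventually_at_in_open')
  then have "\<forall>\<^sub>F b in at a. \<exists>t. set_mset (eigs (TM_chart_inv A c b)) = (\<lambda>z. complex_of_real t * z) ` set_mset (eigs (TM_chart_inv A c a))"
    by eventually_elim (use set_eigs_scale[OF part_facts(1)[OF c] x] in blast)
  then show "isCont (\<lambda>a. \<rho> (TM_chart_inv A c a)) a"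
    unfolding isCont_def using spectral_radius_tendsto[OF eigs_near[OF c a] _ z] by blast
qed

text \<open>The points with a given value and those with any other value form two disjoint open sets covering
  the connected set \<open>W\<close>.\<close>

lemma constant_if_locally_continuous_finite_range:
  fixes g :: "('m, 'n) tpoint \<Rightarrow> 'b::t1_space"
  assumes cont: "\<And>c. c \<in> A \<Longrightarrow> continuous_on (chart_part c) (\<lambda>a. g (TM_chart_inv A c a))"
    and fin: "finite (g ` W)" and xy: "x \<in> W" "y \<in> W"
  shows "g x = g y"
proof (rule ccontr)
  assume neq: "g x \<noteq> g y"
  have op: "openin (TM_topology A) {w \<in> W. g w \<in> U}" if U: "open U" for U
    unfolding openin_TM_topology
  proof (intro conjI ballI)
    show "{w \<in> W. g w \<in> U} \<subseteq> TM A" using in_TM by blast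
    fix c assume c: "c \<in> A"
    have "TM_chart_part A c {w \<in> W. g w \<in> U} = (\<lambda>a. g (TM_chart_inv A c a)) -` U \<inter> chart_part c"
      by (auto simp: TM_chart_part_def)
    then show "open (TM_chart_part A c {w \<in> W. g w \<in> U})"
      using continuous_on_open_vimage[OF part_open[OF c]] cont[OF c] U by metis
  qed
  let ?U = "- (g ` W - {g x})" and ?V = "- {g x}"
  have "open ?U" by (rule open_Compl, rule finite_imp_closed) (simp add: fin)
  have "open ?V" by (rule open_Compl) simp
  define E1 where "E1 = {w \<in> W. g w \<in> ?U}"
  define E2 where "E2 = {w \<in> W. g w \<in> ?V}"
  have "openin (TM_topology A) E1" "openin (TM_topology A) E2"
    unfolding E1_def E2_def by (rule op, fact)+
  moreover have "W \<subseteq> E1 \<union> E2" "E1 \<inter> E2 \<inter> W = {}" "E1 \<inter> W \<noteq> {}" "E2 \<inter> W \<noteq> {}"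
    using xy neq by (auto simp: E1_def E2_def)
  ultimately have "\<exists>E1 E2. openin (TM_topology A) E1 \<and> openin (TM_topology A) E2 \<and>
      W \<subseteq> E1 \<union> E2 \<and> E1 \<inter> E2 \<inter> W = {} \<and> E1 \<inter> W \<noteq> {} \<and> E2 \<inter> W \<noteq> {}"
    by (intro exI conjI)
  then show False using connected_W unfolding connectedin by simp
qed

definition normalized_eigs :: "('m, 'n) tpoint \<Rightarrow> complex multiset" where
  "normalized_eigs x = image_mset (\<lambda>e. e / complex_of_real (\<rho> x)) (eigs x)"

lemma normalized_power_sum:
  assumes "x \<in> W"
  shows "complex_of_real (power_trace k x / \<rho> x ^ k) = (\<Sum>e\<in>#normalized_eigs x. e ^ k)"
proof -
  have "(\<Sum>e\<in>#E. e ^ k) / c = (\<Sum>e\<in>#E. e ^ k / c)" for E and c :: complex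
    by (induction E) (simp_all add: add_divide_distrib)
  then show ?thesis
    by (simp add: normalized_eigs_def power_trace_eigs[OF assms] power_divide image_mset.compositionality o_def)
qed

text \<open>Relative to a fixed point \<open>y\<close> of \<open>W\<close>, the normalized eigenvalues at \<open>x\<close> are those at \<open>y\<close> times the sign of
  \<open>s x y\<close>. They lie in a fixed finite set, and their number is the dimension; only the multiplicities and the
  sign are undetermined.\<close>

lemma finite_normalized_eigs: "finite (normalized_eigs ` W)"
proof (cases "W = {}")
  case False
  then obtain y where y: "y \<in> W" by blast
  define F where "F = (\<lambda>z. z / complex_of_real (\<rho> y)) ` set_mset (eigs y)"
  have sub: "set_mset (normalized_eigs x) \<subseteq> F \<union> uminus ` F" if x: "x \<in> W" for x
  proof
    fix e assume "e \<in># normalized_eigs x"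
    then obtain z where z: "z \<in># eigs y" "e = complex_of_real (s x y) * z / complex_of_real (\<rho> x)"
      by (auto simp: normalized_eigs_def set_eigs_scale[OF x y])
    have "s x y \<noteq> 0" using \<rho>_scale[OF x y] \<rho>_pos[OF x] by auto
    then have "e = z / complex_of_real (\<rho> y) \<or> e = - (z / complex_of_real (\<rho> y))"
      unfolding z(2) \<rho>_scale[OF x y] by (cases "s x y > 0") (auto simp: field_simps)
    then show "e \<in> F \<union> uminus ` F" using z(1) by (auto simp: F_def)
  qed
  have "normalized_eigs ` W \<subseteq> multisets_of_size (F \<union> uminus ` F) CARD('n)"
  proof (rule image_subsetI)
    fix x assume x: "x \<in> W"
    show "normalized_eigs x \<in> multisets_of_size (F \<union> uminus ` F) CARD('n)"
      using sub[OF x] size_eigs[OF x] by (simp add: multisets_of_size_def normalized_eigs_def)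
  qed
  then show ?thesis
    by (rule finite_subset) (intro finite_multisets_of_size, simp add: F_def)
qed simp

text \<open>Each power sum of the normalized eigenvalues is a quotient of a power trace and a power of the spectral
  radius, hence continuous, and it takes finitely many values.\<close>

lemma normalized_eigs_constant:
  assumes "x \<in> W" "y \<in> W"
  shows "normalized_eigs x = normalized_eigs y"
proof (rule mset_eq_of_power_sums)
  fix k
  have "(\<lambda>x. complex_of_real (power_trace k x / \<rho> x ^ k)) ` W = (\<lambda>E. \<Sum>e\<in>#E. e ^ k) ` normalized_eigs ` W"
    unfolding image_image by (rule image_cong[OF refl normalized_power_sum])
  then have fin: "finite ((\<lambda>x. complex_of_real (power_trace k x / \<rho> x ^ k)) ` W)"
    using finite_normalized_eigs by simp
  have "continuous_on (chart_part c) (\<lambda>a. complex_of_real (power_trace k (TM_chart_inv A c a) / \<rho> (TM_chart_inv A c a) ^ k))"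
    if c: "c \<in> A" for c
    using \<rho>_pos part_facts(1)[OF c]
    by (intro continuous_intros \<rho>_continuous_part[OF c] smooth_on_continuous_on[OF power_trace_smooth_part[OF c]]) fastforce
  from constant_if_locally_continuous_finite_range[OF this fin assms]
  show "(\<Sum>e\<in>#normalized_eigs x. e ^ k) = (\<Sum>e\<in>#normalized_eigs y. e ^ k)"
    by (simp only: normalized_power_sum assms)
qed

lemma eigs_scale:
  assumes "x \<in> W" "y \<in> W"
  shows "eigs x = image_mset (\<lambda>z. complex_of_real \<bar>s x y\<bar> * z) (eigs y)"
proof -
  have pos: "\<rho> x > 0" "\<rho> y > 0" using \<rho>_pos assms by auto
  have "eigs x = image_mset (\<lambda>z. complex_of_real (\<rho> x) * z) (normalized_eigs x)"
  proof -
    have "(\<lambda>z. complex_of_real (\<rho> x) * (z / complex_of_real (\<rho> x))) = (\<lambda>z. z)" using pos(1) by auto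
    then show ?thesis by (simp only: normalized_eigs_def image_mset.compositionality o_def multiset.map_ident)
  qed
  also have "\<dots> = image_mset (\<lambda>z. complex_of_real (\<rho> x / \<rho> y) * z) (eigs y)"
    by (subst normalized_eigs_constant[OF assms]) (auto simp: normalized_eigs_def image_mset.compositionality o_def intro!: image_mset_cong)
  also have "\<rho> x / \<rho> y = \<bar>s x y\<bar>" using \<rho>_scale[OF assms] pos by simp
  finally show ?thesis .
qed

lemma power_trace_scale:
  assumes "x \<in> W" "y \<in> W" and eq: "eigs x = image_mset (\<lambda>z. complex_of_real t * z) (eigs y)"
  shows "power_trace k x = t ^ k * power_trace k y"
proof -
  have scale: "(\<Sum>e\<in>#E. (c * e) ^ k) = c ^ k * (\<Sum>e\<in>#E. e ^ k)" for E and c :: complex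
    by (induction E) (simp_all add: power_mult_distrib distrib_left)
  have "complex_of_real (power_trace k x) = (\<Sum>e\<in>#eigs y. (complex_of_real t * e) ^ k)"
    by (simp add: power_trace_eigs[OF assms(1)] eq image_mset.compositionality o_def)
  also have "\<dots> = complex_of_real (t ^ k * power_trace k y)"
    by (simp add: scale power_trace_eigs[OF assms(2)])
  finally show ?thesis by (simp only: of_real_eq_iff)
qed

lemma s_abs_pos: "x \<in> W \<Longrightarrow> y \<in> W \<Longrightarrow> \<bar>s x y\<bar> > 0"
  using \<rho>_scale \<rho>_pos by (metis abs_ge_zero less_eq_real_def less_irrefl mult_zero_left)

text \<open>One power trace that does not vanish at one point serves for all points, since it is multiplied by
  \<open>\<bar>s x y\<bar> ^ k > 0\<close> between any two. Positivity of the quotient is recorded because the root is smooth only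
  away from \<open>0\<close>.\<close>

lemma abs_s_root:
  "\<exists>k>0. \<forall>x\<in>W. \<forall>y\<in>W. power_trace k y \<noteq> 0 \<and> power_trace k x / power_trace k y > 0 \<and> \<bar>s x y\<bar> = root k (power_trace k x / power_trace k y)"
proof (cases "W = {}")
  case True then show ?thesis by (auto intro: exI[of _ 1])
next
  case False
  then obtain w where w: "w \<in> W" by blast
  obtain z where "z \<in># eigs w" "z \<noteq> 0" using eigs_nonzero[OF w] .
  then obtain k where k: "k > 0" "(\<Sum>e\<in>#eigs w. e ^ k) \<noteq> 0" using power_sum_nonzero by metis
  then have tw: "power_trace k w \<noteq> 0" using power_trace_eigs[OF w, of k] by auto
  have "power_trace k y \<noteq> 0 \<and> power_trace k x / power_trace k y > 0 \<and> \<bar>s x y\<bar> = root k (power_trace k x / power_trace k y)" if xy: "x \<in> W" "y \<in> W" for x y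
  proof -
    have y: "power_trace k y \<noteq> 0" using power_trace_scale[OF xy(2) w eigs_scale[OF xy(2) w], of k] tw s_abs_pos[OF xy(2) w] by auto
    then have eq: "power_trace k x / power_trace k y = \<bar>s x y\<bar> ^ k" using power_trace_scale[OF xy eigs_scale[OF xy], of k] by simp
    show ?thesis unfolding eq using y k(1) s_abs_pos[OF xy] by (simp add: real_root_power_cancel)
  qed
  then show ?thesis using k(1) by blast
qed

lemma abs_s_smooth: "smooth_on_TM2 A W (\<lambda>x y. \<bar>s x y\<bar>)"
  unfolding smooth_on_TM2_def
proof (intro ballI)
  fix c d assume c: "c \<in> A" and d: "d \<in> A"
  obtain k where k: "k > 0"
    "\<forall>x\<in>W. \<forall>y\<in>W. power_trace k y \<noteq> 0 \<and> power_trace k x / power_trace k y > 0 \<and> \<bar>s x y\<bar> = root k (power_trace k x / power_trace k y)"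
    using abs_s_root by blast
  let ?S = "chart_part c \<times> chart_part d"
  have S: "open ?S" by (intro open_Times part_open c d)
  let ?f = "\<lambda>b. power_trace k (TM_chart_inv A c (fst b))" and ?g = "\<lambda>b. power_trace k (TM_chart_inv A d (snd b))"
  have W: "TM_chart_inv A c (fst b) \<in> W" "TM_chart_inv A d (snd b) \<in> W" if "b \<in> ?S" for b
    using that part_facts(1)[OF c] part_facts(1)[OF d] by auto
  have f: "smooth_on ?S ?f"
    by (rule smooth_on_compose[OF S part_open[OF c] smooth_on_bounded_linear[OF S bounded_linear_fst] power_trace_smooth_part[OF c]]) auto
  have g: "smooth_on ?S ?g"
    by (rule smooth_on_compose[OF S part_open[OF d] smooth_on_bounded_linear[OF S bounded_linear_snd] power_trace_smooth_part[OF d]]) auto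
  have "smooth_on ?S (\<lambda>b. root k (?f b * inverse (?g b)))"
    using k(2)[rule_format, OF W] by (intro smooth_on_root smooth_on_mult smooth_on_inverse S f g k(1)) (auto simp: divide_inverse)
  then show "smooth_on ?S (\<lambda>(a, b). \<bar>s (TM_chart_inv A c a) (TM_chart_inv A d b)\<bar>)"
    by (rule smooth_on_cong[OF S, rotated]) (use k(2)[rule_format, OF W] in \<open>auto simp: divide_inverse\<close>)
qed

end

theorem lemma1p5:
  fixes A :: "('m::{t2_space, second_countable_topology}, 'n::finite) chart set"
    and nabla :: "('m, 'n) vfield \<Rightarrow> ('m, 'n) vfield \<Rightarrow> ('m, 'n) vfield"
    and \<O> :: "('m, 'n) tpoint set"
    and s :: "('m, 'n) tpoint \<Rightarrow> ('m, 'n) tpoint \<Rightarrow> real"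
  assumes "affine_manifold A nabla"
    and "openin (TM_topology A) \<O>"
    and "connectedin (TM_topology A) \<O>"
    and "\<forall>x\<in>\<O>. \<forall>y\<in>\<O>.
      Spec A (fst x) (jacobi A nabla x)
        = (\<lambda>z. complex_of_real (s x y) * z) ` Spec A (fst y) (jacobi A nabla y) \<and>
      (\<lambda>z. complex_of_real (s x y) * z) ` Spec A (fst y) (jacobi A nabla y) \<noteq> {0}"
  shows
    "(\<forall>x\<in>\<O>. \<forall>y\<in>\<O>.
         Spec_mset A (fst x) (jacobi A nabla x)
           = image_mset (\<lambda>z. complex_of_real (s x y) * z) (Spec_mset A (fst y) (jacobi A nabla y))
         \<longrightarrow> (\<forall>k>0. Tr A (fst x) (jacobi A nabla x ^^ k)
                     = s x y ^ k * Tr A (fst y) (jacobi A nabla y ^^ k)))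
   \<and> (\<forall>x\<in>\<O>. \<forall>y\<in>\<O>.
         Spec A (fst x) (jacobi A nabla x)
           = (\<lambda>z. complex_of_real \<bar>s x y\<bar> * z) ` Spec A (fst y) (jacobi A nabla y) \<and>
         (\<lambda>z. complex_of_real \<bar>s x y\<bar> * z) ` Spec A (fst y) (jacobi A nabla y) \<noteq> {0} \<and>
         Spec_mset A (fst x) (jacobi A nabla x)
           = image_mset (\<lambda>z. complex_of_real \<bar>s x y\<bar> * z)
               (Spec_mset A (fst y) (jacobi A nabla y)))
   \<and> (\<exists>k>0. \<forall>x\<in>\<O>. \<forall>y\<in>\<O>.
         Tr A (fst y) (jacobi A nabla y ^^ k) \<noteq> 0 \<and>
         \<bar>s x y\<bar> = root k (Tr A (fst x) (jacobi A nabla x ^^ k)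
                           / Tr A (fst y) (jacobi A nabla y ^^ k)))
   \<and> smooth_on_TM2 A \<O> (\<lambda>x y. \<bar>s x y\<bar>)"
proof -
  interpret proportional_spectra A nabla \<O> s
  proof
    show "smooth_manifold A" "connection A nabla" "torsion_free A nabla"
      using assms(1) by (simp_all add: affine_manifold_def)
    show "openin (TM_topology A) \<O>" "connectedin (TM_topology A) \<O>"
      by fact+
    show "Spec A (fst x) (jacobi A nabla x)
        = (\<lambda>z. complex_of_real (s x y) * z) ` Spec A (fst y) (jacobi A nabla y) \<and>
      (\<lambda>z. complex_of_real (s x y) * z) ` Spec A (fst y) (jacobi A nabla y) \<noteq> {0}"
      if "x \<in> \<O>" "y \<in> \<O>" for x y
      using bspec[OF bspec[OF assms(4) that(1)] that(2)] .
  qed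
  have traces: "\<forall>x\<in>\<O>. \<forall>y\<in>\<O>. eigs x = image_mset (\<lambda>z. complex_of_real (s x y) * z) (eigs y)
      \<longrightarrow> (\<forall>k>0. power_trace k x = s x y ^ k * power_trace k y)"
    using power_trace_scale by blast
  have spectra: "Spec A (fst x) (jacobi A nabla x)
        = (\<lambda>z. complex_of_real \<bar>s x y\<bar> * z) ` Spec A (fst y) (jacobi A nabla y) \<and>
      (\<lambda>z. complex_of_real \<bar>s x y\<bar> * z) ` Spec A (fst y) (jacobi A nabla y) \<noteq> {0} \<and>
      eigs x = image_mset (\<lambda>z. complex_of_real \<bar>s x y\<bar> * z) (eigs y)"
    if xy: "x \<in> \<O>" "y \<in> \<O>" for x y
  proof -
    have "Spec A (fst x) (jacobi A nabla x) = (\<lambda>z. complex_of_real \<bar>s x y\<bar> * z) ` Spec A (fst y) (jacobi A nabla y)"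
      unfolding Spec_eq[OF xy(1)] Spec_eq[OF xy(2)] by (subst eigs_scale[OF xy]) simp
    moreover have "Spec A (fst x) (jacobi A nabla x) \<noteq> {0}" using proportional[OF xy] by simp
    ultimately show ?thesis using eigs_scale[OF xy] by simp
  qed
  have roots: "\<exists>k>0. \<forall>x\<in>\<O>. \<forall>y\<in>\<O>. power_trace k y \<noteq> 0 \<and> \<bar>s x y\<bar> = root k (power_trace k x / power_trace k y)"
    using abs_s_root by blast
  show ?thesis
  proof (intro conjI)
    show "smooth_on_TM2 A \<O> (\<lambda>x y. \<bar>s x y\<bar>)" by (rule abs_s_smooth)
  qed (use traces roots in \<open>simp_all only: eigs_def power_trace_def\<close>, intro ballI spectra[unfolded eigs_def])
qed

end
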